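(* Let $\mathbb{K}$ be a field and let $A\in\mathbb{K}^{r\times r}$ be a matrix all of whose eigenvalues lie in $\mathbb{K}$. Let $I_A\subseteq\mathbb{K}[x_1,\dots,x_r]$ be the ideal generated by the $2\times2$ minors of the $r\times2$ matrix $(A\boldsymbol{x}\mid\boldsymbol{x})$, where $\boldsymbol{x}=(x_1,\dots,x_r)^T$, and let $Z_A\subseteq\mathbb{P}^{r-1}$ be the closed subscheme defined by $I_A$ (the eigenscheme of $A$). The following conditions are equivalent: (i) the matrix $A$ is diagonalizable; (ii) the ideal $I_A$ is radical; (iii) the eigenscheme $Z_A$ is reduced.
   Context: $(A\boldsymbol{x}\mid\boldsymbol{x})$ is the matrix whose two columns are $A\boldsymbol{x}$ and $\boldsymbol{x}$. *)

theory Defs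
  imports
    "HOL-Library.Poly_Mapping"
    "HOL-Library.FuncSet"
    "HOL-Algebra.QuotRing"
    "HOL-Algebra.Algebraic_Closure_Type"
    "HOL-Analysis.Abstract_Topology"
    "Jordan_Normal_Form.Char_Poly"
    "Jordan_Normal_Form.DL_Submatrix"
begin

section \<open>Commutative algebra\<close>

definition radical_ideal :: "('s, 'm) ring_scheme \<Rightarrow> 's set \<Rightarrow> bool" where
  "radical_ideal R I \<longleftrightarrow>
     ideal I R \<and> (\<forall>a\<in>carrier R. \<forall>n::nat. a [^]\<^bsub>R\<^esub> n \<in> I \<longrightarrow> a \<in> I)"

definition reduced_ring :: "('s, 'm) ring_scheme \<Rightarrow> bool" where
  "reduced_ring R \<longleftrightarrow>
     (\<forall>a\<in>carrier R. \<forall>n::nat. a [^]\<^bsub>R\<^esub> n = \<zero>\<^bsub>R\<^esub> \<longrightarrow> a = \<zero>\<^bsub>R\<^esub>)"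


section \<open>Ringed spaces\<close>

record ('p, 's) ringed_space =
  rs_top :: "'p topology"
  rs_sections :: "'p set \<Rightarrow> 's ring"
  rs_restriction :: "'p set \<Rightarrow> 'p set \<Rightarrow> 's \<Rightarrow> 's"

text \<open>A scheme is reduced if no ring of sections over an open set has a nonzero nilpotent.\<close>

definition reduced_scheme :: "('p, 's) ringed_space \<Rightarrow> bool" where
  "reduced_scheme Y \<longleftrightarrow> (\<forall>U. openin (rs_top Y) U \<longrightarrow> reduced_ring (rs_sections Y U))"


section \<open>Proj of a graded ring\<close>

text \<open>
  Throughout, the grading of \<open>R\<close> is the family \<open>gr\<close> of its homogeneous parts: \<open>gr d\<close> is the set
  of homogeneous elements of degree \<open>d\<close> (including \<open>\<zero>\<close>).
\<close>

definition homogeneous_ideal ::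
    "('s, 'm) ring_scheme \<Rightarrow> (nat \<Rightarrow> 's set) \<Rightarrow> 's set \<Rightarrow> bool" where
  "homogeneous_ideal R gr I \<longleftrightarrow> ideal I R \<and> I = Idl\<^bsub>R\<^esub> (I \<inter> (\<Union>d. gr d))"

definition irrelevant_ideal :: "('s, 'm) ring_scheme \<Rightarrow> (nat \<Rightarrow> 's set) \<Rightarrow> 's set" where
  "irrelevant_ideal R gr = Idl\<^bsub>R\<^esub> (\<Union>d\<in>{0<..}. gr d)"

definition proj_points :: "('s, 'm) ring_scheme \<Rightarrow> (nat \<Rightarrow> 's set) \<Rightarrow> 's set set" where
  "proj_points R gr =
     {p. primeideal p R \<and> homogeneous_ideal R gr p \<and> \<not> irrelevant_ideal R gr \<subseteq> p}"

text \<open>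
  The Zariski topology, with closed sets \<open>V(E) = {p. E \<subseteq> p}\<close>. Letting \<open>E\<close> range over all subsets
  of the ring instead of the homogeneous ideals gives the same closed sets, because the points
  are homogeneous ideals.
\<close>

definition proj_topology :: "('s, 'm) ring_scheme \<Rightarrow> (nat \<Rightarrow> 's set) \<Rightarrow> 's set topology" where
  "proj_topology R gr =
     topology (\<lambda>U. \<exists>E\<subseteq>carrier R. U = {p\<in>proj_points R gr. \<not> E \<subseteq> p})"

lemma openin_proj_topology:
  assumes "ring R"
  shows "openin (proj_topology R gr) U \<longleftrightarrow>
           (\<exists>E\<subseteq>carrier R. U = {p\<in>proj_points R gr. \<not> E \<subseteq> p})"
proof -
  let ?D = "\<lambda>E. {p\<in>proj_points R gr. \<not> E \<subseteq> p}"
  have "istopology (\<lambda>U. \<exists>E\<subseteq>carrier R. U = ?D E)"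
    unfolding istopology_def
  proof (intro conjI allI impI)
    fix S T
    assume "\<exists>E\<subseteq>carrier R. S = ?D E" "\<exists>E\<subseteq>carrier R. T = ?D E"
    then obtain E F where E: "E \<subseteq> carrier R" "S = ?D E" and F: "F \<subseteq> carrier R" "T = ?D F"
      by blast
    let ?G = "{e \<otimes>\<^bsub>R\<^esub> f | e f. e \<in> E \<and> f \<in> F}"
    have "?G \<subseteq> carrier R"
      using E(1) F(1) assms by (auto intro!: monoid.m_closed ring.is_monoid)
    moreover have "\<not> ?G \<subseteq> p \<longleftrightarrow> \<not> E \<subseteq> p \<and> \<not> F \<subseteq> p" if "p \<in> proj_points R gr" for p
    proof -
      interpret primeideal p R using that by (simp add: proj_points_def)
      show ?thesis
      proof (intro iffI conjI)
        assume "\<not> ?G \<subseteq> p"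
        then obtain e f where ef: "e \<in> E" "f \<in> F" "e \<otimes>\<^bsub>R\<^esub> f \<notin> p"
          by blast
        then have "e \<in> carrier R" "f \<in> carrier R"
          using E(1) F(1) by auto
        with ef(3) have "e \<notin> p" "f \<notin> p"
          using I_l_closed I_r_closed by auto
        with ef show "\<not> E \<subseteq> p" "\<not> F \<subseteq> p"
          by auto
      next
        assume "\<not> E \<subseteq> p \<and> \<not> F \<subseteq> p"
        then obtain e f where ef: "e \<in> E" "f \<in> F" "e \<notin> p" "f \<notin> p"
          by blast
        then have "e \<in> carrier R" "f \<in> carrier R"
          using E(1) F(1) by auto
        with ef have "e \<otimes>\<^bsub>R\<^esub> f \<notin> p"
          using I_prime by blast
        with ef show "\<not> ?G \<subseteq> p"
          by blast
      qed
    qed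
    then have "?D ?G = {p\<in>proj_points R gr. \<not> E \<subseteq> p \<and> \<not> F \<subseteq> p}"
      by (rule Collect_cong[OF conj_cong[OF refl]])
    then have "S \<inter> T = ?D ?G"
      unfolding E(2) F(2) by auto
    ultimately show "\<exists>E\<subseteq>carrier R. S \<inter> T = ?D E"
      by (intro exI conjI)
  next
    fix K
    assume "\<forall>U\<in>K. \<exists>E\<subseteq>carrier R. U = ?D E"
    then obtain e where e: "\<And>U. U \<in> K \<Longrightarrow> e U \<subseteq> carrier R \<and> U = ?D (e U)"
      by metis
    have K: "p \<in> U \<longleftrightarrow> p \<in> ?D (e U)" if "U \<in> K" for U p
      using e[OF that] by (elim conjE, intro arg_cong[where f = "\<lambda>S. p \<in> S"])
    have "\<Union>K = ?D (\<Union>U\<in>K. e U)"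
    proof (intro equalityI subsetI)
      fix p assume "p \<in> \<Union>K"
      then obtain U where "U \<in> K" "p \<in> U" by blast
      with K[of U p] show "p \<in> ?D (\<Union>U\<in>K. e U)" by auto
    next
      fix p assume "p \<in> ?D (\<Union>U\<in>K. e U)"
      then obtain U where "U \<in> K" "p \<in> ?D (e U)" by blast
      with K[of U p] show "p \<in> \<Union>K" by auto
    qed
    moreover have "(\<Union>U\<in>K. e U) \<subseteq> carrier R"
      using e by blast
    ultimately show "\<exists>E\<subseteq>carrier R. \<Union>K = ?D E"
      by (intro exI conjI)
  qed
  then show ?thesis
    unfolding proj_topology_def by simp
qed

text \<open>
  The homogeneous localization \<open>R\<^sub>(\<^sub>p\<^sub>)\<close>: fractions \<open>a/f\<close> with \<open>a\<close>, \<open>f\<close> homogeneous of the same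
  degree and \<open>f \<notin> p\<close>. The fraction \<open>a/f\<close> is the class of all pairs \<open>(b, g)\<close> for which
  \<open>t a g = t b f\<close> for some homogeneous \<open>t \<notin> p\<close>.
\<close>

definition hfrac_pairs :: "(nat \<Rightarrow> 's set) \<Rightarrow> 's set \<Rightarrow> ('s \<times> 's) set" where
  "hfrac_pairs gr p = {(a, f). \<exists>d. a \<in> gr d \<and> f \<in> gr d \<and> f \<notin> p}"

definition hfrac ::
    "('s, 'm) ring_scheme \<Rightarrow> (nat \<Rightarrow> 's set) \<Rightarrow> 's set \<Rightarrow> 's \<Rightarrow> 's \<Rightarrow> ('s \<times> 's) set" where
  "hfrac R gr p a f =
     {(b, g)\<in>hfrac_pairs gr p.
        \<exists>t\<in>(\<Union>d. gr d) - p. t \<otimes>\<^bsub>R\<^esub> (a \<otimes>\<^bsub>R\<^esub> g) = t \<otimes>\<^bsub>R\<^esub> (b \<otimes>\<^bsub>R\<^esub> f)}"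

definition hlocalization ::
    "('s, 'm) ring_scheme \<Rightarrow> (nat \<Rightarrow> 's set) \<Rightarrow> 's set \<Rightarrow> ('s \<times> 's) set ring" where
  "hlocalization R gr p =
     \<lparr>carrier = {hfrac R gr p a f | a f. (a, f) \<in> hfrac_pairs gr p},
      monoid.mult = (\<lambda>x y. \<Union>(a, f)\<in>x. \<Union>(b, g)\<in>y. hfrac R gr p (a \<otimes>\<^bsub>R\<^esub> b) (f \<otimes>\<^bsub>R\<^esub> g)),
      one = hfrac R gr p \<one>\<^bsub>R\<^esub> \<one>\<^bsub>R\<^esub>,
      zero = hfrac R gr p \<zero>\<^bsub>R\<^esub> \<one>\<^bsub>R\<^esub>,
      add = (\<lambda>x y. \<Union>(a, f)\<in>x. \<Union>(b, g)\<in>y.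
               hfrac R gr p (a \<otimes>\<^bsub>R\<^esub> g \<oplus>\<^bsub>R\<^esub> b \<otimes>\<^bsub>R\<^esub> f) (f \<otimes>\<^bsub>R\<^esub> g))\<rparr>"

text \<open>
  The structure sheaf: sections over \<open>U\<close> are the families of elements of the homogeneous
  localizations at the points of \<open>U\<close> that are locally given by a single fraction.
\<close>

definition proj_section_set ::
    "('s, 'm) ring_scheme \<Rightarrow> (nat \<Rightarrow> 's set) \<Rightarrow> 's set set \<Rightarrow> ('s set \<Rightarrow> ('s \<times> 's) set) set" where
  "proj_section_set R gr U =
     {s \<in> (\<Pi>\<^sub>E p\<in>U. carrier (hlocalization R gr p)).
        \<forall>p\<in>U. \<exists>V a f d. openin (proj_topology R gr) V \<and> p \<in> V \<and> V \<subseteq> U \<and>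
          a \<in> gr d \<and> f \<in> gr d \<and> (\<forall>q\<in>V. f \<notin> q \<and> s q = hfrac R gr q a f)}"

definition proj_sections ::
    "('s, 'm) ring_scheme \<Rightarrow> (nat \<Rightarrow> 's set) \<Rightarrow> 's set set \<Rightarrow> ('s set \<Rightarrow> ('s \<times> 's) set) ring" where
  "proj_sections R gr U =
     \<lparr>carrier = proj_section_set R gr U,
      monoid.mult = (\<lambda>s t. \<lambda>p\<in>U. s p \<otimes>\<^bsub>hlocalization R gr p\<^esub> t p),
      one = (\<lambda>p\<in>U. \<one>\<^bsub>hlocalization R gr p\<^esub>),
      zero = (\<lambda>p\<in>U. \<zero>\<^bsub>hlocalization R gr p\<^esub>),
      add = (\<lambda>s t. \<lambda>p\<in>U. s p \<oplus>\<^bsub>hlocalization R gr p\<^esub> t p)\<rparr>"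

definition Proj ::
    "('s, 'm) ring_scheme \<Rightarrow> (nat \<Rightarrow> 's set) \<Rightarrow>
      ('s set, 's set \<Rightarrow> ('s \<times> 's) set) ringed_space" where
  "Proj R gr =
     \<lparr>rs_top = proj_topology R gr,
      rs_sections = proj_sections R gr,
      rs_restriction = (\<lambda>U V s. restrict s V)\<rparr>"


section \<open>Polynomial rings and closed subschemes of projective space\<close>

text \<open>
  A polynomial is a finitely supported function from monomials to coefficients, a monomial a
  finitely supported function from variable indices to exponents. The variables
  \<open>x\<^sub>1, \<dots>, x\<^sub>r\<close> are indexed by \<open>0, \<dots>, r - 1\<close>.
\<close>

type_synonym 'a mpol = "(nat \<Rightarrow>\<^sub>0 nat) \<Rightarrow>\<^sub>0 'a"

definition mvar :: "nat \<Rightarrow> 'a::comm_ring_1 mpol" where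
  "mvar i = Poly_Mapping.single (Poly_Mapping.single i 1) 1"

definition mconst :: "'a \<Rightarrow> 'a::comm_ring_1 mpol" where
  "mconst c = Poly_Mapping.single 0 c"

definition mpoly_ring :: "nat \<Rightarrow> 'a::comm_ring_1 mpol ring" where
  "mpoly_ring r =
     \<lparr>carrier = {p. \<forall>m\<in>Poly_Mapping.keys p. Poly_Mapping.keys m \<subseteq> {..<r}},
      monoid.mult = (*), one = 1, zero = 0, add = (+)\<rparr>"

lemma cring_mpoly_ring: "cring (mpoly_ring r)"
proof (rule cringI)
  have keys_add: "Poly_Mapping.keys m \<subseteq> {..<r}"
    if "m \<in> Poly_Mapping.keys (p + q)" "p \<in> carrier (mpoly_ring r)" "q \<in> carrier (mpoly_ring r)"
    for m and p q :: "'a mpol"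
    using that Poly_Mapping.keys_add[of p q] by (auto simp: mpoly_ring_def)
  have keys_mult: "Poly_Mapping.keys m \<subseteq> {..<r}"
    if "m \<in> Poly_Mapping.keys (p * q)" "p \<in> carrier (mpoly_ring r)" "q \<in> carrier (mpoly_ring r)"
    for m and p q :: "'a mpol"
  proof -
    from that(1) obtain a b where "m = a + b" "a \<in> Poly_Mapping.keys p" "b \<in> Poly_Mapping.keys q"
      using Poly_Mapping.keys_mult[of p q] by blast
    moreover from this that(2,3) have "Poly_Mapping.keys a \<subseteq> {..<r}" "Poly_Mapping.keys b \<subseteq> {..<r}"
      by (auto simp: mpoly_ring_def)
    ultimately show ?thesis
      using Poly_Mapping.keys_add[of a b] by blast
  qed
  show "abelian_group (mpoly_ring r :: 'a mpol ring)"
  proof (rule abelian_groupI)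
    fix p :: "'a mpol" assume "p \<in> carrier (mpoly_ring r)"
    then have "- p \<in> carrier (mpoly_ring r)" by (simp add: mpoly_ring_def)
    then show "\<exists>q\<in>carrier (mpoly_ring r). q \<oplus>\<^bsub>mpoly_ring r\<^esub> p = \<zero>\<^bsub>mpoly_ring r\<^esub>"
      by (rule bexI[rotated]) (simp add: mpoly_ring_def)
  qed (use keys_add in \<open>auto simp: mpoly_ring_def ac_simps\<close>)
  show "comm_monoid (mpoly_ring r :: 'a mpol ring)"
    by (rule comm_monoidI) (use keys_mult in \<open>auto simp: mpoly_ring_def ac_simps\<close>)
qed (simp add: mpoly_ring_def algebra_simps)

definition mono_degree :: "(nat \<Rightarrow>\<^sub>0 nat) \<Rightarrow> nat" where
  "mono_degree m = (\<Sum>i\<in>Poly_Mapping.keys m. Poly_Mapping.lookup m i)"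

definition mpoly_grading :: "nat \<Rightarrow> nat \<Rightarrow> 'a::comm_ring_1 mpol set" where
  "mpoly_grading r d =
     {p\<in>carrier (mpoly_ring r). \<forall>m\<in>Poly_Mapping.keys p. mono_degree m = d}"

text \<open>
  The closed subscheme of \<open>\<bbbP>\<^sup>r\<^sup>-\<^sup>1 = Proj K[x\<^sub>1, \<dots>, x\<^sub>r]\<close> defined by a homogeneous ideal \<open>I\<close> is
  \<open>Proj (K[x\<^sub>1, \<dots>, x\<^sub>r]/I)\<close>, with the grading induced on the quotient.
\<close>

definition closed_subscheme ::
    "nat \<Rightarrow> 'a::comm_ring_1 mpol set \<Rightarrow>
      ('a mpol set set, 'a mpol set set \<Rightarrow> ('a mpol set \<times> 'a mpol set) set) ringed_space" where
  "closed_subscheme r I =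
     Proj (mpoly_ring r Quot I) (\<lambda>d. (\<lambda>f. I +>\<^bsub>mpoly_ring r\<^esub> f) ` mpoly_grading r d)"


section \<open>Matrices and the eigenscheme\<close>

definition diagonalizable :: "'a::field mat \<Rightarrow> bool" where
  "diagonalizable A \<longleftrightarrow> (\<exists>D. diagonal_mat D \<and> similar_mat A D)"

definition minors :: "nat \<Rightarrow> 'a::comm_ring_1 mat \<Rightarrow> 'a set" where
  "minors k M =
     {det (submatrix M I J) | I J.
        I \<subseteq> {..<dim_row M} \<and> J \<subseteq> {..<dim_col M} \<and> card I = k \<and> card J = k}"

definition var_vec :: "nat \<Rightarrow> 'a::comm_ring_1 mpol vec" where
  "var_vec r = vec r mvar"

definition eigen_matrix :: "nat \<Rightarrow> 'a::field mat \<Rightarrow> 'a mpol mat" where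
  "eigen_matrix r A = mat_of_cols r [map_mat mconst A *\<^sub>v var_vec r, var_vec r]"

definition eigen_ideal :: "nat \<Rightarrow> 'a::field mat \<Rightarrow> 'a mpol set" where
  "eigen_ideal r A = Idl\<^bsub>mpoly_ring r\<^esub> (minors 2 (eigen_matrix r A))"

definition eigenscheme ::
    "nat \<Rightarrow> 'a::field mat \<Rightarrow>
      ('a mpol set set, 'a mpol set set \<Rightarrow> ('a mpol set \<times> 'a mpol set) set) ringed_space" where
  "eigenscheme r A = closed_subscheme r (eigen_ideal r A)"

text \<open>The eigenvalues of \<open>A\<close> are those in an algebraic closure of the field.\<close>

definition eigenvalues_in_field :: "'a::field mat \<Rightarrow> bool" where
  "eigenvalues_in_field A \<longleftrightarrow>
     (\<forall>\<mu>::'a alg_closure. eigenvalue (map_mat to_ac A) \<mu> \<longrightarrow> \<mu> \<in> Set.range to_ac)"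

end

theory Submission
  imports Defs
begin

text \<open>
  If \<open>A\<close> is diagonalizable, then in eigencoordinates \<open>x\<^sub>k\<close> the ideal contains the products
  \<open>x\<^sub>i x\<^sub>j\<close> of coordinates with different eigenvalues, and a polynomial vanishing on all eigenspaces
  has only monomials divisible by such a product; hence the ideal is radical. A radical ideal has a
  reduced quotient ring, and reducedness passes to homogeneous localizations and to sections.

  If \<open>A\<close> is not diagonalizable, there are vectors \<open>v\<close>, \<open>w \<noteq> 0\<close> with \<open>A v = c v + w\<close> and
  \<open>A w = c w\<close>. On the chart \<open>x\<^sub>i \<noteq> 0\<close> of the eigenscheme the eigenvalue is the function
  \<open>\<Lambda> = (A x)\<^sub>i / x\<^sub>i\<close>, and by Cayley-Hamilton it is a root of the characteristic polynomial, so
  \<open>\<Prod>(\<Lambda> - b)\<close>, taken over the distinct eigenvalues \<open>b\<close>, is nilpotent. It does not vanish in the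
  local ring at \<open>w\<close>, because it takes the value \<open>T \<cdot> \<Prod>\<^bsub>b \<noteq> c\<^esub> (c + T - b) \<noteq> 0\<close> at the point
  \<open>w + T v\<close> over the dual numbers.
\<close>

section \<open>The Cayley-Hamilton theorem\<close>

text \<open>The implications form a cycle (i), (ii), (iii), (i). The scheme \<open>Z_A\<close>
  determines \<open>I_A\<close> only up to saturation by the irrelevant ideal, so its reducedness
  does not directly make \<open>I_A\<close> radical; the way back therefore goes through the matrix.
  The product of the \<open>\<Lambda> - b\<close> over distinct \<open>b\<close> is the natural
  nilpotent candidate: \<open>\<Lambda>\<close> takes eigenvalues of \<open>A\<close> at the
  \<open>K\<close>-points of \<open>Z_A\<close>, so the product vanishes at all of them, and the
  multiplicities in the characteristic polynomial only affect the exponent. A chain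
  \<open>v\<close>, \<open>w\<close> is a tangent direction at the point of \<open>w\<close> along
  which the eigenvalue moves to first order. Such a chain is found without the Jordan form: once the
  characteristic polynomial splits, eigenvectors span the space as soon as \<open>A - c\<close> and
  its square have the same kernel for every \<open>c\<close>. Since \<open>K\<close> may be finite,
  vanishing on an eigenspace or a line always means vanishing after substituting a parametrization,
  not vanishing at all \<open>K\<close>-points.\<close>

definition mat_poly :: "'a::comm_ring_1 mat \<Rightarrow> 'a poly \<Rightarrow> 'a mat" where
  "mat_poly A q = fold_coeffs (\<lambda>c M. c \<cdot>\<^sub>m 1\<^sub>m (dim_row A) + A * M) q (0\<^sub>m (dim_row A) (dim_row A))"

context
  fixes A :: "'a::comm_ring_1 mat" and n :: nat
  assumes A: "A \<in> carrier_mat n n"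
begin

lemma mat_poly_0: "mat_poly A 0 = 0\<^sub>m n n"
  using A by (simp add: mat_poly_def)

lemma mat_poly_pCons: "mat_poly A (pCons c q) = c \<cdot>\<^sub>m 1\<^sub>m n + A * mat_poly A q"
proof (cases "c = 0 \<and> q = 0")
  case True
  then show ?thesis using A by (auto simp: mat_poly_0 intro!: eq_matI)
next
  case False
  then show ?thesis using A
    by (auto simp: mat_poly_def fold_coeffs_pCons_coeff_not_0_eq fold_coeffs_pCons_not_0_0_eq)
qed

lemma mat_poly_carrier [simp]: "mat_poly A q \<in> carrier_mat n n"
  using A by (induction q) (auto simp: mat_poly_0 mat_poly_pCons)

lemma mat_poly_dim [simp]: "dim_row (mat_poly A q) = n" "dim_col (mat_poly A q) = n"
  using carrier_matD[OF mat_poly_carrier[of q]] by auto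

lemma mat_poly_add: "mat_poly A (p + q) = mat_poly A p + mat_poly A q"
proof (induction p q rule: poly_induct2)
  case 0
  then show ?case by (simp add: mat_poly_0)
next
  case (pCons a p b q)
  have 1: "A * (mat_poly A p + mat_poly A q) = A * mat_poly A p + A * mat_poly A q"
    using A by (intro mult_add_distrib_mat) auto
  show ?case using A
    by (auto simp: mat_poly_pCons pCons 1 algebra_simps intro!: eq_matI)
qed

lemma mat_poly_smult: "mat_poly A (smult c p) = c \<cdot>\<^sub>m mat_poly A p"
proof (induction p)
  case 0
  then show ?case by (auto simp: mat_poly_0)
next
  case (pCons a p)
  have 1: "A * (c \<cdot>\<^sub>m mat_poly A p) = c \<cdot>\<^sub>m (A * mat_poly A p)"
    using A by (intro mult_smult_distrib) auto
  show ?case using A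
    by (auto simp: mat_poly_pCons pCons 1 algebra_simps intro!: eq_matI)
qed

lemma mat_poly_pCons_0: "mat_poly A (pCons 0 p) = A * mat_poly A p"
  using A by (auto simp: mat_poly_pCons intro!: eq_matI)

lemma mat_poly_commute: "A * mat_poly A p = mat_poly A p * A"
proof (induction p)
  case 0
  then show ?case using A by (auto simp: mat_poly_0)
next
  case (pCons a p)
  have "A * mat_poly A (pCons a p) = A * (a \<cdot>\<^sub>m 1\<^sub>m n) + A * (A * mat_poly A p)"
    using A unfolding mat_poly_pCons by (intro mult_add_distrib_mat) auto
  also have "A * (a \<cdot>\<^sub>m 1\<^sub>m n) = (a \<cdot>\<^sub>m 1\<^sub>m n) * A"
    using A by (auto simp: mult_smult_distrib mult_smult_assoc_mat)
  also have "A * (A * mat_poly A p) = A * mat_poly A p * A"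
    by (subst pCons) (rule assoc_mult_mat[symmetric, OF A mat_poly_carrier A])
  also have "(a \<cdot>\<^sub>m 1\<^sub>m n) * A + A * mat_poly A p * A = mat_poly A (pCons a p) * A"
    using A unfolding mat_poly_pCons by (intro add_mult_distrib_mat[symmetric]) auto
  finally show ?case .
qed

lemma mat_poly_sum_index:
  assumes "i < n" "j < n"
  shows "mat_poly A (\<Sum>x\<in>S. f x) $$ (i, j) = (\<Sum>x\<in>S. mat_poly A (f x) $$ (i, j))"
  using assms by (induction S rule: infinite_finite_induct) (auto simp: mat_poly_0 mat_poly_add)

text \<open>\<open>A\<close> stands to the right of \<open>q(A)\<close>, which is possible because
  the two commute. In this order a row of \<open>q(A)\<close> can serve as the coefficient vector of
  a linear form that is applied to \<open>A x\<close>.\<close>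

lemma mat_poly_linear_factor:
  assumes "i < n" "j < n"
  shows "mat_poly A ([:- c, 1:] * q) $$ (i, j) =
    (\<Sum>k<n. mat_poly A q $$ (i, k) * A $$ (k, j)) - c * mat_poly A q $$ (i, j)"
proof -
  have eq: "[:- c, 1:] * q = pCons 0 q + smult (- c) q"
    by simp
  have "(mat_poly A q * A) $$ (i, j) = (\<Sum>k<n. mat_poly A q $$ (i, k) * A $$ (k, j))"
    using A assms by (auto simp: scalar_prod_def atLeast0LessThan)
  then show ?thesis
    using A assms unfolding eq mat_poly_add mat_poly_smult mat_poly_pCons_0 mat_poly_commute
    by auto
qed

text \<open>Evaluating \<open>(X - A) * adj(X - A) = char_poly A\<close> at \<open>X = A\<close>, with the powers of \<open>A\<close> on the left.\<close>
theorem cayley_hamilton: "mat_poly A (char_poly A) = 0\<^sub>m n n"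
proof (rule eq_matI)
  fix i k assume ik: "i < dim_row (0\<^sub>m n n :: 'a mat)" "k < dim_col (0\<^sub>m n n :: 'a mat)"
  then have i: "i < n" and k: "k < n" by auto
  let ?M = "char_poly_matrix A"
  let ?B = "adj_mat ?M"
  have M: "?M \<in> carrier_mat n n" using A by simp
  have B: "?B \<in> carrier_mat n n" using adj_mat(1)[OF M] .
  have entry: "(?M * ?B) $$ (j, k) =
      pCons 0 (?B $$ (j, k)) + (\<Sum>l<n. smult (- (A $$ (j, l))) (?B $$ (l, k)))" if "j < n" for j
  proof -
    have "(?M * ?B) $$ (j, k) = (\<Sum>l<n. ?M $$ (j, l) * ?B $$ (l, k))"
      using M B that k by (auto simp: scalar_prod_def atLeast0LessThan)
    also have "\<dots> = (\<Sum>l<n. (if l = j then pCons 0 (?B $$ (l, k)) else 0)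
        + smult (- (A $$ (j, l))) (?B $$ (l, k)))"
      using A that by (intro sum.cong) (auto simp: char_poly_matrix_def)
    finally show ?thesis using that by (simp only: sum.distrib) (simp add: sum.delta)
  qed
  \<comment> \<open>Each polynomial entry of column \<open>k\<close> is evaluated at
    \<open>A\<close>. Multiplication by \<open>X\<close> becomes right multiplication by
    \<open>A\<close>, so the two halves of \<open>X - A\<close> produce the same double sum with
    \<open>j\<close> and \<open>l\<close> exchanged.\<close>
  have "(\<Sum>j<n. mat_poly A ((?M * ?B) $$ (j, k)) $$ (i, j)) =
      (\<Sum>j<n. \<Sum>l<n. mat_poly A (?B $$ (j, k)) $$ (i, l) * A $$ (l, j)) -
      (\<Sum>j<n. \<Sum>l<n. A $$ (j, l) * mat_poly A (?B $$ (l, k)) $$ (i, j))"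
  proof -
    have "mat_poly A (pCons 0 q) $$ (i, j) = (\<Sum>l<n. mat_poly A q $$ (i, l) * A $$ (l, j))"
      if "j < n" for j q
      using A i that unfolding mat_poly_pCons_0 mat_poly_commute
      by (auto simp: scalar_prod_def atLeast0LessThan)
    then show ?thesis
      using i by (simp add: entry mat_poly_add mat_poly_sum_index mat_poly_smult
          sum.distrib sum_negf sum_subtractf del: smult_minus_left)
  qed
  also have "\<dots> = 0"
    by (subst sum.swap) (simp add: mult.commute)
  finally have "(\<Sum>j<n. mat_poly A ((?M * ?B) $$ (j, k)) $$ (i, j)) = 0" .
  moreover have "(?M * ?B) $$ (j, k) = (if j = k then char_poly A else 0)" if "j < n" for j
    using that k adj_mat(2)[OF M] by (simp add: char_poly_def)
  ultimately have "(\<Sum>j<n. if j = k then mat_poly A (char_poly A) $$ (i, j) else 0) = 0"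
    using i by (simp add: mat_poly_0 if_distrib[of "mat_poly A"] if_distrib[of "\<lambda>M. M $$ _"] cong: if_cong)
  then show "mat_poly A (char_poly A) $$ (i, k) = 0\<^sub>m n n $$ (i, k)"
    using i k by simp
qed auto

end

text \<open>Over the algebraic closure the monic characteristic polynomial factors. Its roots are
  eigenvalues, so they come from the field by hypothesis, and the factorization descends because
  \<open>map_poly to_ac\<close> is injective.\<close>

lemma char_poly_splits:
  fixes A :: "'a::field mat"
  assumes A: "A \<in> carrier_mat n n" and ev: "eigenvalues_in_field A"
  shows "\<exists>cs. char_poly A = (\<Prod>c\<leftarrow>cs. [:- c, 1:])"
proof -
  interpret to_ac: inj_comm_ring_hom "to_ac :: 'a \<Rightarrow> 'a alg_closure"
    by unfold_locales auto
  interpret map_poly_to_ac: map_poly_inj_comm_ring_hom "to_ac :: 'a \<Rightarrow> 'a alg_closure" ..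
  let ?p = "map_poly to_ac (char_poly A)"
  have cp: "char_poly (map_mat to_ac A) = ?p"
    using to_ac.char_poly_hom[OF A] .
  have lc: "lead_coeff (char_poly A) = 1"
    using degree_monic_char_poly[OF A] by auto
  then have lc_p: "lead_coeff ?p = 1" by simp
  have "?p \<noteq> 0" using lc by auto
  from alg_closed_imp_factorization[OF this]
  obtain B where B: "?p = (\<Prod>x\<in>#B. [:- x, 1:])"
    unfolding lc_p smult_1_left by blast
  obtain bs where bs: "mset bs = B" using ex_mset by blast
  have fac: "?p = (\<Prod>b\<leftarrow>bs. [:- b, 1:])"
    unfolding B bs[symmetric] mset_map[symmetric] prod_mset_prod_list ..
  have "b \<in> range to_ac" if "b \<in> set bs" for b
  proof -
    have "poly ?p b = 0"
      unfolding fac using that by (auto simp: poly_prod_list o_def prod_list_zero_iff)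
    then have "eigenvalue (map_mat to_ac A) b"
      using eigenvalue_root_char_poly[of "map_mat to_ac A" n b] A cp by auto
    then show ?thesis using ev unfolding eigenvalues_in_field_def by blast
  qed
  then obtain cs where cs: "bs = map to_ac cs"
    by (metis ex_map_conv imageE)
  have "?p = map_poly to_ac (\<Prod>c\<leftarrow>cs. [:- c, 1:])"
    unfolding fac cs by (induction cs) (simp_all add: hom_distribs)
  then show ?thesis by auto
qed

section \<open>A criterion for diagonalizability\<close>

text \<open>The sum of all eigenspaces, built one eigenvector at a time to allow induction. Scalars
  are absorbed into \<open>b\<close>, which may also be zero.\<close>

inductive_set eigen_span :: "'a::field mat \<Rightarrow> 'a vec set" for A where
  zero: "0\<^sub>v (dim_row A) \<in> eigen_span A"
| add: "\<lbrakk>u \<in> eigen_span A; b \<in> carrier_vec (dim_row A); A *\<^sub>v b = c \<cdot>\<^sub>v b\<rbrakk> \<Longrightarrow> u + b \<in> eigen_span A"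

lemma eigen_span_carrier:
  assumes "u \<in> eigen_span A"
  shows "u \<in> carrier_vec (dim_row A)"
  using assms by induction auto

text \<open>On an eigenvector with eigenvalue \<open>d\<close> the map \<open>A - c\<close> is
  multiplication by \<open>d - c\<close>: it is invertible for \<open>d \<noteq> c\<close>, which
  contributes to \<open>z\<close>, and zero for \<open>d = c\<close>, which contributes to
  \<open>w\<close>.\<close>

lemma eigen_span_shift:
  assumes A: "A \<in> carrier_mat n n" and "u \<in> eigen_span A"
  shows "\<exists>z\<in>eigen_span A. \<exists>w\<in>carrier_vec n. u = (A *\<^sub>v z - c \<cdot>\<^sub>v z) + w \<and> A *\<^sub>v w = c \<cdot>\<^sub>v w"
  using assms(2)
proof induction
  case zero
  show ?case using A
    by (intro bexI[of _ "0\<^sub>v n"] bexI[of _ "0\<^sub>v n"]) (auto intro: eigen_span.zero[of A, simplified])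
next
  case (add u b d)
  have n: "dim_row A = n" using A by auto
  from add.IH obtain z w where z: "z \<in> eigen_span A" and w: "w \<in> carrier_vec n"
    and u: "u = (A *\<^sub>v z - c \<cdot>\<^sub>v z) + w" and Aw: "A *\<^sub>v w = c \<cdot>\<^sub>v w" by blast
  have zc: "z \<in> carrier_vec n" using eigen_span_carrier[OF z] n by simp
  have b: "b \<in> carrier_vec n" using add.hyps n by simp
  show ?case
  proof (cases "d = c")
    case True
    have "A *\<^sub>v (w + b) = c \<cdot>\<^sub>v (w + b)"
      using A w b Aw add.hyps True by (simp add: mult_add_distrib_mat_vec smult_add_distrib_vec)
    moreover have "u + b = (A *\<^sub>v z - c \<cdot>\<^sub>v z) + (w + b)"
      unfolding u using A zc w b by auto
    ultimately show ?thesis using z w b by (intro bexI[of _ z] bexI[of _ "w + b"]) auto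
  next
    case False
    let ?b = "(1 / (d - c)) \<cdot>\<^sub>v b"
    have Ab: "A *\<^sub>v ?b = d \<cdot>\<^sub>v ?b"
      using A b add.hyps by (simp add: mult_mat_vec smult_smult_assoc mult.commute)
    have z': "z + ?b \<in> eigen_span A"
      using eigen_span.add[OF z _ Ab] b n by auto
    have "u + b = (A *\<^sub>v (z + ?b) - c \<cdot>\<^sub>v (z + ?b)) + w"
    proof -
      have "A *\<^sub>v (z + ?b) = A *\<^sub>v z + d \<cdot>\<^sub>v ?b"
        using A zc b Ab by (simp add: mult_add_distrib_mat_vec)
      moreover have "d * (1 / (d - c) * x) = x + c * (1 / (d - c) * x)" for x
        using False by (simp add: field_simps)
      ultimately show ?thesis
        unfolding u using A zc w b by (intro eq_vecI) (auto simp: distrib_left simp del: times_divide_eq_left)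
    qed
    then show ?thesis using z' w Aw by blast
  qed
qed

lemma mat_poly_linear_factor_vec:
  assumes A: "A \<in> carrier_mat n n" and u: "u \<in> carrier_vec n"
  shows "mat_poly A ([:- c, 1:] * q) *\<^sub>v u = mat_poly A q *\<^sub>v (A *\<^sub>v u - c \<cdot>\<^sub>v u)"
proof (rule eq_vecI)
  let ?Q = "\<lambda>i j. mat_poly A q $$ (i, j)"
  note [simp] = mat_poly_dim[OF A]
  fix i assume "i < dim_vec (mat_poly A q *\<^sub>v (A *\<^sub>v u - c \<cdot>\<^sub>v u))"
  then have i: "i < n" by simp
  have "(mat_poly A ([:- c, 1:] * q) *\<^sub>v u) $ i =
      (\<Sum>j<n. ((\<Sum>k<n. ?Q i k * A $$ (k, j)) - c * ?Q i j) * u $ j)"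
    using i u by (simp add: scalar_prod_def atLeast0LessThan mat_poly_linear_factor[OF A] del: mult_pCons_left)
  also have "\<dots> = (\<Sum>j<n. \<Sum>k<n. ?Q i k * (A $$ (k, j) * u $ j)) - (\<Sum>j<n. c * (?Q i j * u $ j))"
    by (simp add: left_diff_distrib sum_subtractf sum_distrib_right mult.assoc)
  also have "\<dots> = (\<Sum>k<n. ?Q i k * ((\<Sum>j<n. A $$ (k, j) * u $ j) - c * u $ k))"
    by (subst sum.swap) (simp add: right_diff_distrib sum_subtractf sum_distrib_left mult.left_commute[of c])
  also have "\<dots> = (mat_poly A q *\<^sub>v (A *\<^sub>v u - c \<cdot>\<^sub>v u)) $ i"
    using i u A by (simp add: scalar_prod_def atLeast0LessThan)
  finally show "(mat_poly A ([:- c, 1:] * q) *\<^sub>v u) $ i = (mat_poly A q *\<^sub>v (A *\<^sub>v u - c \<cdot>\<^sub>v u)) $ i" .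
qed (simp add: mat_poly_dim[OF A])

text \<open>The kernels of \<open>A - c\<close> and of its square agree for every \<open>c\<close>,
  so there is no Jordan chain of length two. The negation directly supplies a vector
  \<open>u\<close> and a nonzero eigenvector \<open>A u - c u\<close>.\<close>

definition semisimple_mat :: "'a::field mat \<Rightarrow> bool" where
  "semisimple_mat A \<longleftrightarrow> (\<forall>c. \<forall>u\<in>carrier_vec (dim_row A).
     A *\<^sub>v (A *\<^sub>v u - c \<cdot>\<^sub>v u) = c \<cdot>\<^sub>v (A *\<^sub>v u - c \<cdot>\<^sub>v u) \<longrightarrow> A *\<^sub>v u = c \<cdot>\<^sub>v u)"

text \<open>Peel off one linear factor: \<open>(A - c) u\<close> is annihilated by the remaining
  ones, hence equals \<open>(A - c) z + w\<close> with \<open>z\<close> in the span and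
  \<open>A w = c w\<close>. Then \<open>(A - c) (u - z) = w\<close> is killed by
  \<open>A - c\<close>, so semisimplicity makes \<open>u - z\<close> itself an eigenvector (or
  zero).\<close>

lemma eigen_span_if_annihilated:
  assumes A: "A \<in> carrier_mat n n" and "semisimple_mat A" and "u \<in> carrier_vec n"
    and "mat_poly A (\<Prod>c\<leftarrow>cs. [:- c, 1:]) *\<^sub>v u = 0\<^sub>v n"
  shows "u \<in> eigen_span A"
  using assms(3,4)
proof (induction cs arbitrary: u)
  case Nil
  have "mat_poly A 1 = 1\<^sub>m n"
    using A by (auto simp: one_pCons mat_poly_pCons[OF A] mat_poly_0[OF A] intro!: eq_matI)
  then show ?case using Nil A eigen_span.zero[of A] by auto
next
  case (Cons c cs)
  have n: "dim_row A = n" using A by auto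
  let ?u = "A *\<^sub>v u - c \<cdot>\<^sub>v u"
  have u: "?u \<in> carrier_vec n" using A Cons.prems by auto
  have "?u \<in> eigen_span A"
    using Cons.prems by (intro Cons.IH u) (simp add: mat_poly_linear_factor_vec[OF A] del: mult_pCons_left)
  from eigen_span_shift[OF A this, of c] obtain z w
    where z: "z \<in> eigen_span A" and w: "w \<in> carrier_vec n"
      and eq: "?u = (A *\<^sub>v z - c \<cdot>\<^sub>v z) + w" and Aw: "A *\<^sub>v w = c \<cdot>\<^sub>v w" by blast
  have zc: "z \<in> carrier_vec n" using eigen_span_carrier[OF z] n by simp
  have 1: "A *\<^sub>v (u - z) = A *\<^sub>v u - A *\<^sub>v z"
    using A Cons.prems zc by (simp add: mult_minus_distrib_mat_vec)
  have "A *\<^sub>v (u - z) - c \<cdot>\<^sub>v (u - z) = w"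
  proof (rule eq_vecI)
    fix i assume "i < dim_vec w"
    then have i: "i < n" using w by auto
    have "?u $ i = ((A *\<^sub>v z - c \<cdot>\<^sub>v z) + w) $ i" using eq by simp
    then show "(A *\<^sub>v (u - z) - c \<cdot>\<^sub>v (u - z)) $ i = w $ i"
      unfolding 1 using i A w zc Cons.prems by (simp add: algebra_simps)
  qed (use w A zc in auto)
  then have "A *\<^sub>v (u - z) = c \<cdot>\<^sub>v (u - z)"
    using assms(2) Aw Cons.prems zc n unfolding semisimple_mat_def by auto
  then have "z + (u - z) \<in> eigen_span A"
    using Cons.prems zc n by (intro eigen_span.add[OF z]) auto
  moreover have "z + (u - z) = u" using zc Cons.prems by auto
  ultimately show ?case by simp
qed

text \<open>The determinant is linear in each column, so each standard basis vector can be traded for one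
  of the eigenvectors that span the space without the determinant becoming zero.\<close>
lemma eigenvector_columns:
  fixes A :: "'a::field mat"
  assumes A: "A \<in> carrier_mat n n" and span: "carrier_vec n \<subseteq> eigen_span A" and "k \<le> n"
  shows "\<exists>P\<in>carrier_mat n n. det P \<noteq> 0 \<and> (\<forall>j<k. \<exists>c. A *\<^sub>v col P j = c \<cdot>\<^sub>v col P j)"
  using assms(3)
proof (induction k)
  case 0
  show ?case by (intro bexI[of _ "1\<^sub>m n"]) auto
next
  case (Suc k)
  then obtain P where P: "P \<in> carrier_mat n n" and det: "det P \<noteq> 0"
    and ev: "\<And>j. j < k \<Longrightarrow> \<exists>c. A *\<^sub>v col P j = c \<cdot>\<^sub>v col P j" by auto
  have k: "k < n" using Suc.prems by simp
  have n: "dim_row A = n" using A by auto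
  \<comment> \<open>The determinant of \<open>P\<close> with column \<open>k\<close> replaced by
    \<open>u\<close>, expanded along that column. It is linear in \<open>u\<close> and nonzero at
    \<open>col P k\<close>, so it cannot vanish on all eigenvectors.\<close>
  let ?f = "\<lambda>u :: 'a vec. \<Sum>i<n. u $ i * cofactor P i k"
  have "\<exists>b\<in>carrier_vec n. \<exists>c. A *\<^sub>v b = c \<cdot>\<^sub>v b \<and> ?f b \<noteq> 0"
  proof (rule ccontr)
    assume none: "\<not> ?thesis"
    have zero: "?f u = 0" if "u \<in> eigen_span A" for u
      using that
    proof induction
      case (add u b c)
      then have "?f b = 0" using none n by blast
      moreover have "?f (u + b) = ?f u + ?f b"
        using add.hyps n by (simp add: sum.distrib[symmetric] algebra_simps)
      ultimately show ?case using add.IH by simp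
    qed (simp add: n)
    have "col P k \<in> carrier_vec n" using P by (intro carrier_vecI) simp
    then have "col P k \<in> eigen_span A" using span by blast
    then have "?f (col P k) = 0" by (rule zero)
    moreover have "?f (col P k) = det P"
      unfolding laplace_expansion_column[OF P k] using P k by (intro sum.cong) auto
    ultimately show False using det by simp
  qed
  then obtain b c where b: "b \<in> carrier_vec n" "A *\<^sub>v b = c \<cdot>\<^sub>v b" "?f b \<noteq> 0" by blast
  define P' where "P' = mat n n (\<lambda>(i, j). if j = k then b $ i else P $$ (i, j))"
  have P': "P' \<in> carrier_mat n n" by (simp add: P'_def)
  have "mat_delete P' i k = mat_delete P i k" if "i < n" for i
    using P k that by (auto simp: P'_def mat_delete_def intro!: eq_matI)
  then have "det P' = ?f b"
    unfolding laplace_expansion_column[OF P' k] using k by (auto simp: P'_def cofactor_def intro!: sum.cong)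
  moreover have "col P' j = (if j = k then b else col P j)" if "j < n" for j
    using that P b by (auto simp: P'_def)
  ultimately show ?case using b ev k P' by (intro bexI[OF _ P']) (auto simp: less_Suc_eq)
qed

lemma diagonalizable_if_eigenvector_columns:
  fixes A :: "'a::field mat"
  assumes A: "A \<in> carrier_mat n n" and P: "P \<in> carrier_mat n n" and det: "det P \<noteq> 0"
    and ev: "\<forall>j<n. \<exists>c. A *\<^sub>v col P j = c \<cdot>\<^sub>v col P j"
  shows "diagonalizable A"
proof -
  obtain d where d: "\<And>j. j < n \<Longrightarrow> A *\<^sub>v col P j = d j \<cdot>\<^sub>v col P j" using ev by metis
  define D where "D = mat n n (\<lambda>(i, j). if i = j then d j else 0)"
  define Q where "Q = (1 / det P) \<cdot>\<^sub>m adj_mat P"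
  have D: "D \<in> carrier_mat n n" by (simp add: D_def)
  have Q: "Q \<in> carrier_mat n n" using adj_mat(1)[OF P] by (simp add: Q_def)
  have PQ: "P * Q = 1\<^sub>m n" "Q * P = 1\<^sub>m n"
    using adj_mat[OF P] P det
    by (auto simp: Q_def mult_smult_distrib[OF P adj_mat(1)[OF P]] mult_smult_assoc_mat[OF adj_mat(1)[OF P] P] intro!: eq_matI)
  have "A * P = P * D"
  proof (rule eq_matI)
    fix i j assume "i < dim_row (P * D)" "j < dim_col (P * D)"
    then have ij: "i < n" "j < n" using P D by auto
    have "(A * P) $$ (i, j) = (A *\<^sub>v col P j) $ i" using A P ij by auto
    also have "\<dots> = d j * P $$ (i, j)" using d[OF ij(2)] P ij by simp
    also have "\<dots> = (\<Sum>l<n. if l = j then P $$ (i, l) * d j else 0)" using ij by simp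
    also have "\<dots> = (P * D) $$ (i, j)"
      using P ij by (auto simp: scalar_prod_def D_def atLeast0LessThan simp del: sum.delta intro!: sum.cong)
    finally show "(A * P) $$ (i, j) = (P * D) $$ (i, j)" .
  qed (use A P D in auto)
  then have "P * D * Q = A * P * Q" by simp
  also have "\<dots> = A * (P * Q)" using A P Q by (rule assoc_mult_mat)
  finally have "A = P * D * Q" using A PQ by simp
  then have "similar_mat A D" using A P D Q PQ by (intro similar_matI[of _ _ P Q n]) auto
  moreover have "diagonal_mat D" by (auto simp: D_def diagonal_mat_def)
  ultimately show ?thesis unfolding diagonalizable_def by blast
qed

lemma diagonalizable_if_semisimple:
  fixes A :: "'a::field mat"
  assumes A: "A \<in> carrier_mat n n" and "semisimple_mat A" and "eigenvalues_in_field A"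
  shows "diagonalizable A"
proof -
  obtain cs where "char_poly A = (\<Prod>c\<leftarrow>cs. [:- c, 1:])"
    using char_poly_splits[OF A assms(3)] by blast
  with cayley_hamilton[OF A] have "mat_poly A (\<Prod>c\<leftarrow>cs. [:- c, 1:]) = 0\<^sub>m n n" by simp
  then have "u \<in> eigen_span A" if "u \<in> carrier_vec n" for u
    using that by (intro eigen_span_if_annihilated[OF A assms(2) that, of cs]) auto
  then obtain P where "P \<in> carrier_mat n n" "det P \<noteq> 0" "\<forall>j<n. \<exists>c. A *\<^sub>v col P j = c \<cdot>\<^sub>v col P j"
    using eigenvector_columns[OF A, of n] by blast
  then show ?thesis by (rule diagonalizable_if_eigenvector_columns[OF A])
qed

section \<open>Evaluation of polynomials\<close>

text \<open>One evaluation serves several targets: the field itself for points,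
  \<open>'a poly\<close> for parametrized lines, and polynomials again for linear substitutions. The
  map \<open>h\<close> carries the coefficients along.\<close>

definition mpoly_eval :: "('a::comm_ring_1 \<Rightarrow> 'b::comm_ring_1) \<Rightarrow> (nat \<Rightarrow> 'b) \<Rightarrow> 'a mpol \<Rightarrow> 'b" where
  "mpoly_eval h g p = (\<Sum>m\<in>Poly_Mapping.keys p.
     h (Poly_Mapping.lookup p m) * (\<Prod>i\<in>Poly_Mapping.keys m. g i ^ Poly_Mapping.lookup m i))"

lemma monomial_eval_superset:
  assumes "finite I" "Poly_Mapping.keys m \<subseteq> I"
  shows "(\<Prod>i\<in>Poly_Mapping.keys m. g i ^ Poly_Mapping.lookup m i) =
    (\<Prod>i\<in>I. (g i :: 'b::comm_ring_1) ^ Poly_Mapping.lookup m i)"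
  using assms by (intro prod.mono_neutral_left) (auto simp: in_keys_iff)

lemma monomial_eval_add:
  "(\<Prod>i\<in>Poly_Mapping.keys (a + b). (g i :: 'b::comm_ring_1) ^ Poly_Mapping.lookup (a + b) i) =
   (\<Prod>i\<in>Poly_Mapping.keys a. g i ^ Poly_Mapping.lookup a i) *
   (\<Prod>i\<in>Poly_Mapping.keys b. g i ^ Poly_Mapping.lookup b i)"
proof -
  let ?I = "Poly_Mapping.keys a \<union> Poly_Mapping.keys b"
  have "(\<Prod>i\<in>Poly_Mapping.keys m. g i ^ Poly_Mapping.lookup m i) = (\<Prod>i\<in>?I. g i ^ Poly_Mapping.lookup m i)"
    if "m \<in> {a, b, a + b}" for m
    using that Poly_Mapping.keys_add[of a b] by (intro monomial_eval_superset) auto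
  from this[of a] this[of b] this[of "a + b"] show ?thesis
    by (simp only: insert_iff simp_thms lookup_add power_add prod.distrib)
qed

locale mpoly_eval_hom = comm_ring_hom h
  for h :: "'a::comm_ring_1 \<Rightarrow> 'b::comm_ring_1" and g :: "nat \<Rightarrow> 'b"
begin

abbreviation ev where "ev \<equiv> mpoly_eval h g"

lemma eval_superset:
  assumes "finite S" "Poly_Mapping.keys p \<subseteq> S"
  shows "ev p = (\<Sum>m\<in>S. h (Poly_Mapping.lookup p m) * (\<Prod>i\<in>Poly_Mapping.keys m. g i ^ Poly_Mapping.lookup m i))"
  unfolding mpoly_eval_def using assms by (intro sum.mono_neutral_left) (auto simp: in_keys_iff)

lemma eval_0 [simp]: "ev 0 = 0"
  by (simp add: mpoly_eval_def)

lemma eval_add: "ev (p + q) = ev p + ev q"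
proof -
  let ?S = "Poly_Mapping.keys p \<union> Poly_Mapping.keys q"
  show ?thesis
    using Poly_Mapping.keys_add[of p q]
    by (simp add: eval_superset[of ?S] lookup_add hom_add distrib_right sum.distrib)
qed

lemma eval_single:
  "ev (Poly_Mapping.single m c) = h c * (\<Prod>i\<in>Poly_Mapping.keys m. g i ^ Poly_Mapping.lookup m i)"
  by (simp add: mpoly_eval_def)

lemma eval_1 [simp]: "ev 1 = 1"
  using eval_single[of 0 1] by simp

lemma eval_sum: "ev (sum f S) = (\<Sum>x\<in>S. ev (f x))"
  by (induction S rule: infinite_finite_induct) (auto simp: eval_add)

end

lemma poly_mapping_sum_monomials:
  "(\<Sum>m\<in>Poly_Mapping.keys p. Poly_Mapping.single m (Poly_Mapping.lookup p m)) = p"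
proof (rule poly_mapping_eqI)
  fix k
  show "Poly_Mapping.lookup (\<Sum>m\<in>Poly_Mapping.keys p. Poly_Mapping.single m (Poly_Mapping.lookup p m)) k =
      Poly_Mapping.lookup p k"
    by (auto simp: lookup_sum lookup_single when_def in_keys_iff)
qed

context mpoly_eval_hom
begin

lemma eval_mult: "ev (p * q) = ev p * ev q"
proof -
  let ?m = "\<lambda>p m. Poly_Mapping.single m (Poly_Mapping.lookup p m)"
  have "ev (p * q) = ev ((\<Sum>m\<in>Poly_Mapping.keys p. ?m p m) * (\<Sum>n\<in>Poly_Mapping.keys q. ?m q n))"
    by (simp add: poly_mapping_sum_monomials)
  also have "\<dots> = (\<Sum>m\<in>Poly_Mapping.keys p. \<Sum>n\<in>Poly_Mapping.keys q. ev (?m p m) * ev (?m q n))"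
    by (simp add: sum_product eval_sum mult_single eval_single hom_mult monomial_eval_add mult_ac)
  also have "\<dots> = ev (\<Sum>m\<in>Poly_Mapping.keys p. ?m p m) * ev (\<Sum>n\<in>Poly_Mapping.keys q. ?m q n)"
    by (simp add: sum_product eval_sum)
  finally show ?thesis by (simp add: poly_mapping_sum_monomials)
qed

sublocale eval: comm_ring_hom "mpoly_eval h g"
  by unfold_locales (auto simp: eval_add eval_mult)

lemmas eval_comm_ring_hom = eval.comm_ring_hom_axioms

lemma eval_mvar [simp]: "ev (mvar i) = g i"
  by (simp add: mvar_def eval_single)

lemma eval_mconst [simp]: "ev (mconst c) = h c"
  by (simp add: mconst_def eval_single)

end

lemma mconst_hom: "comm_ring_hom mconst"
  by unfold_locales (simp_all add: mconst_def single_add mult_single)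

interpretation mconst: comm_ring_hom mconst
  by (rule mconst_hom)

interpretation mpoly_subst: mpoly_eval_hom mconst g for g ..

lemma single_eq_monomial:
  "Poly_Mapping.single m c = mconst c * (\<Prod>i\<in>Poly_Mapping.keys m. mvar i ^ Poly_Mapping.lookup m i)"
proof -
  have pow: "(mvar i :: 'a mpol) ^ k = Poly_Mapping.single (Poly_Mapping.single i k) 1" for i k
    by (induction k) (simp_all add: mvar_def mult_single single_add[symmetric] add.commute)
  have "(\<Prod>i\<in>I. (mvar i :: 'a mpol) ^ Poly_Mapping.lookup m i) =
      Poly_Mapping.single (\<Sum>i\<in>I. Poly_Mapping.single i (Poly_Mapping.lookup m i)) 1" if "finite I" for I
    using that by induction (simp_all add: pow mult_single)
  from this[of "Poly_Mapping.keys m"] show ?thesis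
    by (simp add: poly_mapping_sum_monomials mconst_def mult_single)
qed

lemma mpoly_hom_eq_eval:
  assumes "comm_ring_hom f"
  shows "f p = mpoly_eval (\<lambda>c. f (mconst c)) (\<lambda>i. f (mvar i)) p"
proof -
  interpret comm_ring_hom f by fact
  have "f p = f (\<Sum>m\<in>Poly_Mapping.keys p. Poly_Mapping.single m (Poly_Mapping.lookup p m))"
    by (simp add: poly_mapping_sum_monomials)
  then show ?thesis
    by (simp add: mpoly_eval_def hom_sum single_eq_monomial hom_mult hom_prod hom_power)
qed

lemma mpoly_eval_cong:
  assumes "p \<in> carrier (mpoly_ring r)" "\<And>i. i < r \<Longrightarrow> g i = g' i"
  shows "mpoly_eval h g p = mpoly_eval h g' p"
  unfolding mpoly_eval_def
proof (intro sum.cong prod.cong refl arg_cong2[of _ _ _ _ "(*)"])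
  fix m i assume "m \<in> Poly_Mapping.keys p" "i \<in> Poly_Mapping.keys m"
  then have "i < r" using assms(1) by (auto simp: mpoly_ring_def)
  then show "g i ^ Poly_Mapping.lookup m i = g' i ^ Poly_Mapping.lookup m i"
    using assms(2) by simp
qed

text \<open>The type has infinitely many variables; membership in the carrier is what reduces the
  comparison to the first \<open>r\<close> of them.\<close>

lemma mpoly_homs_eqI:
  assumes "comm_ring_hom f" "comm_ring_hom f'" "p \<in> carrier (mpoly_ring r)"
    and "\<And>c. f (mconst c) = f' (mconst c)" "\<And>i. i < r \<Longrightarrow> f (mvar i) = f' (mvar i)"
  shows "f p = f' p"
  using mpoly_hom_eq_eval[OF assms(1), of p] mpoly_hom_eq_eval[OF assms(2), of p]
    mpoly_eval_cong[OF assms(3), of "\<lambda>i. f (mvar i)"] assms(4,5) by simp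

section \<open>Closure properties of the polynomial ring and its ideals\<close>

lemma mpoly_ring_simps [simp]:
  "(\<otimes>\<^bsub>mpoly_ring r\<^esub>) = (*)" "\<one>\<^bsub>mpoly_ring r\<^esub> = 1" "\<zero>\<^bsub>mpoly_ring r\<^esub> = 0" "(\<oplus>\<^bsub>mpoly_ring r\<^esub>) = (+)"
  by (simp_all add: mpoly_ring_def)

lemma mpoly_ring_nat_pow [simp]: "p [^]\<^bsub>mpoly_ring r\<^esub> (n::nat) = p ^ n"
  by (induction n) (simp_all add: nat_pow_def mult.commute)

interpretation mpoly_ring: cring "mpoly_ring r" for r
  by (rule cring_mpoly_ring)

lemma mpoly_ring_mult_closed: "p \<in> carrier (mpoly_ring r) \<Longrightarrow> q \<in> carrier (mpoly_ring r) \<Longrightarrow> p * q \<in> carrier (mpoly_ring r)"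
  using mpoly_ring.m_closed[of p r q] by simp

lemma mpoly_ring_add_closed: "p \<in> carrier (mpoly_ring r) \<Longrightarrow> q \<in> carrier (mpoly_ring r) \<Longrightarrow> p + q \<in> carrier (mpoly_ring r)"
  using mpoly_ring.a_closed[of p r q] by simp

lemma mpoly_ring_uminus [simp]:
  assumes "p \<in> carrier (mpoly_ring r)"
  shows "\<ominus>\<^bsub>mpoly_ring r\<^esub> p = - p"
proof -
  have "- p \<in> carrier (mpoly_ring r)" using assms by (simp add: mpoly_ring_def)
  then show ?thesis using assms by (intro mpoly_ring.minus_equality) auto
qed

lemma mpoly_ring_uminus_closed: "p \<in> carrier (mpoly_ring r) \<Longrightarrow> - p \<in> carrier (mpoly_ring r)"
  by (simp add: mpoly_ring_def)

lemma mpoly_ring_diff_closed: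
  "p \<in> carrier (mpoly_ring r) \<Longrightarrow> q \<in> carrier (mpoly_ring r) \<Longrightarrow> p - q \<in> carrier (mpoly_ring r)"
  using mpoly_ring_add_closed[OF _ mpoly_ring_uminus_closed, of p r q] by simp

lemma mpoly_ring_mconst_closed: "mconst c \<in> carrier (mpoly_ring r)"
  by (simp add: mpoly_ring_def mconst_def)

lemma mpoly_ring_mvar_closed: "i < r \<Longrightarrow> mvar i \<in> carrier (mpoly_ring r)"
  by (simp add: mpoly_ring_def mvar_def)

lemma mpoly_ring_zero_closed: "0 \<in> carrier (mpoly_ring r)"
  using mpoly_ring.zero_closed by simp

lemma mpoly_ring_one_closed: "1 \<in> carrier (mpoly_ring r)"
  using mpoly_ring.one_closed by simp

lemma mpoly_ring_power_closed: "p \<in> carrier (mpoly_ring r) \<Longrightarrow> p ^ n \<in> carrier (mpoly_ring r)"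
  using mpoly_ring.nat_pow_closed[of p r n] by simp

lemma mpoly_ring_sum_closed: "(\<And>x. x \<in> S \<Longrightarrow> f x \<in> carrier (mpoly_ring r)) \<Longrightarrow> sum f S \<in> carrier (mpoly_ring r)"
  by (induction S rule: infinite_finite_induct) (auto intro: mpoly_ring_zero_closed mpoly_ring_add_closed)

lemma mpoly_ring_prod_closed: "(\<And>x. x \<in> S \<Longrightarrow> f x \<in> carrier (mpoly_ring r)) \<Longrightarrow> prod f S \<in> carrier (mpoly_ring r)"
  by (induction S rule: infinite_finite_induct) (auto intro: mpoly_ring_one_closed mpoly_ring_mult_closed)

lemmas mpoly_ring_closed = mpoly_ring_mult_closed mpoly_ring_add_closed mpoly_ring_uminus_closed mpoly_ring_diff_closed
  mpoly_ring_mconst_closed mpoly_ring_mvar_closed mpoly_ring_zero_closed mpoly_ring_one_closed mpoly_ring_power_closed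
  mpoly_ring_sum_closed mpoly_ring_prod_closed

lemma mpoly_subst_closed:
  assumes "p \<in> carrier (mpoly_ring r)" "\<And>i. i < r \<Longrightarrow> g i \<in> carrier (mpoly_ring r)"
  shows "mpoly_eval mconst g p \<in> carrier (mpoly_ring r)"
  unfolding mpoly_eval_def
proof (intro mpoly_ring_closed)
  fix m i assume "m \<in> Poly_Mapping.keys p" "i \<in> Poly_Mapping.keys m"
  then have "i < r" using assms(1) by (auto simp: mpoly_ring_def)
  then show "g i \<in> carrier (mpoly_ring r)" by (rule assms(2))
qed

text \<open>With \<open>c = 0\<close> this is the kernel of \<open>f\<close>.\<close>
lemma ideal_dvd_vimage:
  assumes "comm_ring_hom f"
  shows "ideal {p\<in>carrier (mpoly_ring r). c dvd f p} (mpoly_ring r)"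
proof -
  interpret comm_ring_hom f by fact
  show ?thesis
  proof (rule idealI)
    show "subgroup {p\<in>carrier (mpoly_ring r). c dvd f p} (add_monoid (mpoly_ring r))"
      by (rule mpoly_ring.add.subgroupI)
        (auto simp: hom_add hom_uminus a_inv_def[symmetric] intro: mpoly_ring_closed)
  qed (auto simp: hom_mult intro: mpoly_ring_closed mpoly_ring.ring_axioms)
qed

lemma ideal_mpoly_ring_add: "ideal I (mpoly_ring r) \<Longrightarrow> p \<in> I \<Longrightarrow> q \<in> I \<Longrightarrow> p + q \<in> I"
  using additive_subgroup.a_closed[OF ideal.axioms(1), of I "mpoly_ring r" p q] by simp

lemma ideal_mpoly_ring_zero: "ideal I (mpoly_ring r) \<Longrightarrow> 0 \<in> I"
  using additive_subgroup.zero_closed[OF ideal.axioms(1), of I "mpoly_ring r"] by simp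

lemma ideal_mpoly_ring_mult: "ideal I (mpoly_ring r) \<Longrightarrow> p \<in> I \<Longrightarrow> q \<in> carrier (mpoly_ring r) \<Longrightarrow> q * p \<in> I"
  using ideal.I_l_closed[of I "mpoly_ring r" p q] by simp

lemma ideal_mpoly_ring_sum: "ideal I (mpoly_ring r) \<Longrightarrow> (\<And>x. x \<in> S \<Longrightarrow> f x \<in> I) \<Longrightarrow> sum f S \<in> I"
  by (induction S rule: infinite_finite_induct) (auto intro: ideal_mpoly_ring_add ideal_mpoly_ring_zero)

section \<open>The ideal of the eigenscheme\<close>

definition lform :: "nat \<Rightarrow> (nat \<Rightarrow> 'a) \<Rightarrow> 'a::comm_ring_1 mpol" where
  "lform r c = (\<Sum>k<r. mconst (c k) * mvar k)"

lemma lform_closed: "lform r c \<in> carrier (mpoly_ring r)"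
  unfolding lform_def by (intro mpoly_ring_closed) auto

lemma lform_cong: "(\<And>k. k < r \<Longrightarrow> c k = d k) \<Longrightarrow> lform r c = lform r d"
  by (simp add: lform_def)

lemma sum_mult_lform:
  "(\<Sum>i<n. mconst (c i) * lform r (B i)) = lform r (\<lambda>k. \<Sum>i<n. c i * B i k)"
  unfolding lform_def sum_distrib_left
  by (subst sum.swap) (simp add: mconst.hom_sum mconst.hom_mult sum_distrib_right mult.assoc)

lemma mult_lform: "mconst a * lform r c = lform r (\<lambda>k. a * c k)"
  by (simp add: lform_def mconst.hom_mult sum_distrib_left mult.assoc)

lemma lform_unit: "i < r \<Longrightarrow> lform r (\<lambda>k. if k = i then 1 else 0) = mvar i"
  by (simp add: lform_def if_distrib[of mconst] if_distrib[of "\<lambda>x. x * _"] cong: if_cong)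

lemma lform_minus: "lform r (\<lambda>k. c k - d k) = lform r c - lform r d"
  by (simp add: lform_def mconst.hom_minus left_diff_distrib sum_subtractf)

lemma (in mpoly_eval_hom) eval_lform: "ev (lform r c) = (\<Sum>k<r. h (c k) * g k)"
  by (simp add: lform_def eval.hom_sum eval.hom_mult)

definition eigen_minor :: "nat \<Rightarrow> 'a::field mat \<Rightarrow> nat \<Rightarrow> nat \<Rightarrow> 'a mpol" where
  "eigen_minor r A i j =
     lform r (\<lambda>k. A $$ (i, k)) * mvar j - lform r (\<lambda>k. A $$ (j, k)) * mvar i"

section \<open>Explicit formula for minors of size two\<close>

lemma det_2_by_2:
  fixes M :: "'a::comm_ring_1 mat"
  assumes M: "M \<in> carrier_mat 2 2"
  shows "det M = M $$ (0, 0) * M $$ (1, 1) - M $$ (1, 0) * M $$ (0, 1)"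
proof -
  have "det M = (\<Sum>i<2. M $$ (i, 0) * cofactor M i 0)"
    by (rule laplace_expansion_column[OF M]) simp
  also have "\<dots> = M $$ (0, 0) * cofactor M 0 0 + M $$ (1, 0) * cofactor M 1 0"
    by (simp add: numeral_2_eq_2)
  finally have det: "det M = M $$ (0, 0) * cofactor M 0 0 + M $$ (1, 0) * cofactor M 1 0" .
  have "mat_delete M 0 0 = mat 1 1 (\<lambda>_. M $$ (1, 1))" "mat_delete M 1 0 = mat 1 1 (\<lambda>_. M $$ (0, 1))"
    using M by (auto simp: mat_delete_def intro!: eq_matI)
  then have "cofactor M 0 0 = M $$ (1, 1)" "cofactor M 1 0 = - M $$ (0, 1)"
    by (simp_all add: cofactor_def det_single)
  with det show ?thesis by (simp add: algebra_simps)
qed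

lemma pick_pair:
  fixes i j :: nat
  assumes "i < j"
  shows "pick {i, j} 0 = i" "pick {i, j} 1 = j"
proof -
  have c: "card {i, j} = 2" using assms by simp
  have "pick {i, j} 0 \<in> {i, j}" "pick {i, j} 1 \<in> {i, j}" "pick {i, j} 0 < pick {i, j} 1"
    using pick_in_set[of 0 "{i, j}"] pick_in_set[of 1 "{i, j}"] pick_mono[of 1 "{i, j}" 0] c by auto
  then show "pick {i, j} 0 = i" "pick {i, j} 1 = j" using assms by auto
qed

lemma det_submatrix_pair:
  fixes M :: "'a::comm_ring_1 mat"
  assumes "i < j" "j < dim_row M" "k < l" "l < dim_col M"
  shows "det (submatrix M {i, j} {k, l}) = M $$ (i, k) * M $$ (j, l) - M $$ (j, k) * M $$ (i, l)"
proof -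
  have sets: "{a. a < dim_row M \<and> a \<in> {i, j}} = {i, j}" "{a. a < dim_col M \<and> a \<in> {k, l}} = {k, l}"
    using assms by auto
  have cards: "card {i, j} = 2" "card {k, l} = 2" using assms by auto
  have S: "submatrix M {i, j} {k, l} \<in> carrier_mat 2 2"
    by (rule carrier_matI) (simp_all only: dim_submatrix sets cards)
  have idx: "submatrix M {i, j} {k, l} $$ (a, b) = M $$ (pick {i, j} a, pick {k, l} b)" if "a < 2" "b < 2" for a b
    by (rule submatrix_index) (simp_all only: sets cards that)
  show ?thesis
    unfolding det_2_by_2[OF S]
    by (simp add: idx pick_pair[OF assms(1)] pick_pair[OF assms(3)] del: pick.simps One_nat_def)
qed

lemma minors_2:
  fixes M :: "'a::comm_ring_1 mat"
  assumes "dim_col M = 2"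
  shows "minors 2 M = {M $$ (i, 0) * M $$ (j, 1) - M $$ (j, 0) * M $$ (i, 1) | i j. i < j \<and> j < dim_row M}"
    (is "_ = ?R")
proof (intro equalityI subsetI)
  fix x assume "x \<in> minors 2 M"
  then obtain I J where x: "x = det (submatrix M I J)"
    and IJ: "I \<subseteq> {..<dim_row M}" "J \<subseteq> {..<2}" "card I = 2" "card J = 2"
    using assms by (auto simp: minors_def)
  have "J = {..<2}" using IJ by (intro card_subset_eq) auto
  then have J: "J = {0, 1}" by auto
  obtain a b where "I = {a, b}" "a \<noteq> b" using IJ(3) by (auto simp: card_2_iff)
  then obtain i j where I: "I = {i, j}" "i < j" by (metis insert_commute linorder_neqE_nat)
  then have "j < dim_row M" using IJ by auto
  then have "x = M $$ (i, 0) * M $$ (j, 1) - M $$ (j, 0) * M $$ (i, 1)"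
    unfolding x J I(1) using I(2) assms by (intro det_submatrix_pair) auto
  then show "x \<in> ?R" using I(2) \<open>j < dim_row M\<close> by blast
next
  fix x assume "x \<in> ?R"
  then obtain i j where ij: "i < j" "j < dim_row M"
    and x: "x = M $$ (i, 0) * M $$ (j, 1) - M $$ (j, 0) * M $$ (i, 1)" by blast
  have "x = det (submatrix M {i, j} {0, 1})"
    unfolding x using ij assms by (intro det_submatrix_pair[symmetric]) auto
  then show "x \<in> minors 2 M"
    unfolding minors_def using ij assms by (intro CollectI exI[of _ "{i, j}"] exI[of _ "{0, 1}"]) auto
qed

locale eigen_ideal_context =
  fixes r :: nat and A :: "'a::field mat"
  assumes A: "A \<in> carrier_mat r r"
begin

abbreviation "Ax i \<equiv> lform r (\<lambda>k. A $$ (i, k))"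

lemma minors_eigen_matrix: "minors 2 (eigen_matrix r A) = {eigen_minor r A i j | i j. i < j \<and> j < r}"
proof -
  have dim: "dim_col (eigen_matrix r A) = 2" "dim_row (eigen_matrix r A) = r"
    by (simp_all add: eigen_matrix_def)
  have "eigen_matrix r A $$ (i, 0) = Ax i" "eigen_matrix r A $$ (i, 1) = mvar i" if "i < r" for i
    using A that by (simp_all add: eigen_matrix_def mat_of_cols_index var_vec_def scalar_prod_def lform_def atLeast0LessThan)
  then have *: "eigen_matrix r A $$ (i, 0) * eigen_matrix r A $$ (j, 1) - eigen_matrix r A $$ (j, 0) * eigen_matrix r A $$ (i, 1) =
      eigen_minor r A i j" if "i < j" "j < r" for i j
    using that by (simp add: eigen_minor_def)
  show ?thesis unfolding minors_2[OF dim(1)] dim(2)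
    by (intro Collect_cong iff_exI) (auto simp: * simp del: One_nat_def)
qed

lemma eigen_minor_closed: "i < r \<Longrightarrow> j < r \<Longrightarrow> eigen_minor r A i j \<in> carrier (mpoly_ring r)"
  unfolding eigen_minor_def by (intro mpoly_ring_closed lform_closed) auto

lemma minors_subset: "minors 2 (eigen_matrix r A) \<subseteq> carrier (mpoly_ring r)"
  unfolding minors_eigen_matrix by (auto intro!: eigen_minor_closed)

lemma ideal_eigen_ideal: "ideal (eigen_ideal r A) (mpoly_ring r)"
  unfolding eigen_ideal_def by (rule mpoly_ring.genideal_ideal[OF minors_subset])

lemma eigen_ideal_subset: "eigen_ideal r A \<subseteq> carrier (mpoly_ring r)"
  using additive_subgroup.a_subset[OF ideal.axioms(1)[OF ideal_eigen_ideal]] .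

text \<open>Only index pairs \<open>i < j\<close> give generators; antisymmetry of the minor covers
  the remaining pairs.\<close>

lemma eigen_minor_in_eigen_ideal:
  assumes "i < r" "j < r"
  shows "eigen_minor r A i j \<in> eigen_ideal r A"
proof -
  have *: "eigen_minor r A i j \<in> eigen_ideal r A" if "i < j" "j < r" for i j
    using mpoly_ring.genideal_self[OF minors_subset] that unfolding eigen_ideal_def minors_eigen_matrix by blast
  have "eigen_minor r A j i = - 1 * eigen_minor r A i j" by (simp add: eigen_minor_def)
  moreover have "eigen_minor r A i i = 0" by (simp add: eigen_minor_def)
  ultimately show ?thesis
    using *[of i j] *[of j i] assms ideal_mpoly_ring_mult[OF ideal_eigen_ideal, of "eigen_minor r A j i" "- 1"] ideal_mpoly_ring_zero[OF ideal_eigen_ideal]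
    by (cases i j rule: linorder_cases) (auto simp: eigen_minor_def intro: mpoly_ring_closed)
qed

text \<open>Vanishing is phrased as divisibility to cover two uses: \<open>c = 0\<close> says that
  \<open>f\<close> kills the ideal, and \<open>c = T^2\<close> that it does so over the dual
  numbers.\<close>

lemma eigen_ideal_dvd_hom:
  assumes f: "comm_ring_hom f" and "\<And>i j. i < j \<Longrightarrow> j < r \<Longrightarrow> c dvd f (eigen_minor r A i j)" and "p \<in> eigen_ideal r A"
  shows "c dvd f p"
proof -
  have "eigen_ideal r A \<subseteq> {p\<in>carrier (mpoly_ring r). c dvd f p}"
    unfolding eigen_ideal_def using assms(2)
    by (intro mpoly_ring.genideal_minimal[OF ideal_dvd_vimage[OF f]])
      (auto simp: minors_eigen_matrix intro!: eigen_minor_closed)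
  then show ?thesis using assms(3) by blast
qed

text \<open>The generators are the coordinates of the wedge of \<open>A x\<close> and
  \<open>x\<close>, so the ideal also contains the pairing of this wedge with any two linear
  functionals \<open>c\<close> and \<open>d\<close>. This makes minors available in eigencoordinates
  and for rows of polynomials in \<open>A\<close>.\<close>

lemma general_minor_in_eigen_ideal:
  "(\<Sum>i<r. mconst (c i) * Ax i) * lform r d - (\<Sum>j<r. mconst (d j) * Ax j) * lform r c \<in> eigen_ideal r A"
proof -
  have "(\<Sum>i<r. mconst (c i) * Ax i) * lform r d - (\<Sum>j<r. mconst (d j) * Ax j) * lform r c =
      (\<Sum>i<r. \<Sum>j<r. mconst (c i) * mconst (d j) * (Ax i * mvar j)) -
      (\<Sum>j<r. \<Sum>i<r. mconst (c i) * mconst (d j) * (Ax j * mvar i))"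
    unfolding lform_def[of r c] lform_def[of r d] sum_product by (simp add: mult_ac)
  also have "\<dots> = (\<Sum>i<r. \<Sum>j<r. (mconst (c i) * mconst (d j)) * eigen_minor r A i j)"
    by (subst (2) sum.swap) (simp add: eigen_minor_def right_diff_distrib sum_subtractf)
  also have "\<dots> \<in> eigen_ideal r A"
    by (intro ideal_mpoly_ring_sum[OF ideal_eigen_ideal] ideal_mpoly_ring_mult[OF ideal_eigen_ideal] eigen_minor_in_eigen_ideal mpoly_ring_closed) auto
  finally show ?thesis .
qed

end

section \<open>Diagonalizable matrices\<close>

lemma mpoly_eval_restrict_vars:
  "mpoly_eval mconst (\<lambda>l. if S l then mvar l else 0) p =
    (\<Sum>m\<in>{m\<in>Poly_Mapping.keys p. \<forall>l\<in>Poly_Mapping.keys m. S l}. Poly_Mapping.single m (Poly_Mapping.lookup p m))"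
proof -
  have "mconst (Poly_Mapping.lookup p m) *
      (\<Prod>l\<in>Poly_Mapping.keys m. (if S l then mvar l else 0) ^ Poly_Mapping.lookup m l) =
      (if \<forall>l\<in>Poly_Mapping.keys m. S l then Poly_Mapping.single m (Poly_Mapping.lookup p m) else 0)" for m
  proof (cases "\<forall>l\<in>Poly_Mapping.keys m. S l")
    case True
    then show ?thesis by (simp add: single_eq_monomial cong: prod.cong)
  next
    case False
    then obtain l where l: "l \<in> Poly_Mapping.keys m" "\<not> S l" by blast
    then have "(\<Prod>l\<in>Poly_Mapping.keys m. (if S l then mvar l else 0 :: 'a mpol) ^ Poly_Mapping.lookup m l) = 0"
      by (intro prod_zero) (auto simp: in_keys_iff power_0_left intro!: bexI[of _ l])
    then show ?thesis using False by (simp only: if_False mult_zero_right)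
  qed
  then show ?thesis by (simp add: mpoly_eval_def sum.If_cases Int_def conj_commute)
qed

text \<open>Monomials that survive restriction to a coordinate subspace stay distinct and cannot
  cancel. In eigencoordinates, vanishing on an eigenspace thus becomes a condition on each monomial
  separately.\<close>

lemma mpoly_eval_restrict_vars_eq_0D:
  assumes "mpoly_eval mconst (\<lambda>l. if S l then mvar l else 0) p = 0" "m \<in> Poly_Mapping.keys p"
  shows "\<exists>l\<in>Poly_Mapping.keys m. \<not> S l"
proof (rule ccontr)
  assume "\<not> ?thesis"
  then have "Poly_Mapping.lookup (mpoly_eval mconst (\<lambda>l. if S l then mvar l else 0) p) m = Poly_Mapping.lookup p m"
    using assms(2) unfolding mpoly_eval_restrict_vars by (simp add: lookup_sum lookup_single when_def)
  then show False using assms by (simp add: in_keys_iff)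
qed

theorem radical_eigen_ideal_if_diagonalizable:
  fixes A :: "'a::field mat"
  assumes A: "A \<in> carrier_mat r r" and "diagonalizable A"
  shows "radical_ideal (mpoly_ring r) (eigen_ideal r A)"
proof -
  interpret eigen_ideal_context r A by unfold_locales (rule A)
  let ?I = "eigen_ideal r A"
  obtain D P Q where diag: "diagonal_mat D" and mats: "{A, D, P, Q} \<subseteq> carrier_mat r r"
    and PQ: "P * Q = 1\<^sub>m r" "Q * P = 1\<^sub>m r" and eq: "A = P * D * Q"
    using assms unfolding diagonalizable_def similar_mat_def similar_mat_wit_def Let_def by auto
  have D: "D \<in> carrier_mat r r" and P: "P \<in> carrier_mat r r" and Q: "Q \<in> carrier_mat r r"
    using mats by auto
  define d where "d k = D $$ (k, k)" for k
  have D_index: "D $$ (i, j) = (if i = j then d i else 0)" if "i < r" "j < r" for i j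
    using diag D that by (auto simp: diagonal_mat_def d_def)
  have "A * P = P * D * (Q * P)"
    unfolding eq using P D Q by (intro assoc_mult_mat) auto
  then have "A * P = P * D" using PQ P D by simp
  have AP: "(\<Sum>k<r. A $$ (i, k) * P $$ (k, l)) = d l * P $$ (i, l)" if "i < r" "l < r" for i l
  proof -
    have "(\<Sum>k<r. A $$ (i, k) * P $$ (k, l)) = (A * P) $$ (i, l)"
      using A P that by (simp add: scalar_prod_def atLeast0LessThan)
    also have "\<dots> = (\<Sum>k<r. P $$ (i, k) * D $$ (k, l))"
      unfolding \<open>A * P = P * D\<close> using P D that by (simp add: scalar_prod_def atLeast0LessThan)
    also have "\<dots> = (\<Sum>k<r. if k = l then d l * P $$ (i, l) else 0)"
      using that by (intro sum.cong) (auto simp: D_index)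
    finally show ?thesis using that by simp
  qed
  have "Q * A = Q * P * (D * Q)"
    unfolding eq using P D Q by (simp add: assoc_mult_mat[of _ r r _ r _ r])
  then have "Q * A = D * Q" using PQ Q D by simp
  have QA: "(\<Sum>i<r. Q $$ (k, i) * A $$ (i, l)) = d k * Q $$ (k, l)" if "k < r" "l < r" for k l
  proof -
    have "(\<Sum>i<r. Q $$ (k, i) * A $$ (i, l)) = (Q * A) $$ (k, l)"
      using A Q that by (simp add: scalar_prod_def atLeast0LessThan)
    also have "\<dots> = (\<Sum>i<r. D $$ (k, i) * Q $$ (i, l))"
      unfolding \<open>Q * A = D * Q\<close> using Q D that by (simp add: scalar_prod_def atLeast0LessThan)
    also have "\<dots> = (\<Sum>i<r. if i = k then d k * Q $$ (k, l) else 0)"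
      using that by (intro sum.cong) (auto simp: D_index)
    finally show ?thesis using that by simp
  qed
  \<comment> \<open>The rows of \<open>Q\<close>, the inverse of \<open>P\<close>, are left
    eigenvectors by \<open>QA\<close>, so applying \<open>A\<close> multiplies the coordinate
    \<open>x k\<close> by \<open>d k\<close>. The general minor for rows \<open>i\<close> and
    \<open>j\<close> is therefore \<open>(d i - d j) * (x i * x j)\<close>.\<close>
  define x where "x k = lform r (\<lambda>l. Q $$ (k, l))" for k
  have x_closed: "x k \<in> carrier (mpoly_ring r)" for k unfolding x_def by (rule lform_closed)
  have xx: "x i * x j \<in> ?I" if "i < r" "j < r" "d i \<noteq> d j" for i j
  proof -
    have "(\<Sum>l<r. mconst (Q $$ (k, l)) * Ax l) = mconst (d k) * x k" if "k < r" for k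
      unfolding sum_mult_lform x_def mult_lform[of "d k"] using that by (intro lform_cong) (simp add: QA)
    then have "mconst (d i) * x i * x j - mconst (d j) * x j * x i \<in> ?I"
      using general_minor_in_eigen_ideal[of "\<lambda>l. Q $$ (i, l)" "\<lambda>l. Q $$ (j, l)"] that by (simp add: x_def)
    moreover have "mconst (d i) * x i * x j - mconst (d j) * x j * x i = mconst (d i - d j) * (x i * x j)"
      by (simp add: mconst.hom_minus algebra_simps)
    ultimately have "mconst (1 / (d i - d j)) * (mconst (d i - d j) * (x i * x j)) \<in> ?I"
      by (simp only: ideal_mpoly_ring_mult[OF ideal_eigen_ideal _ mpoly_ring_mconst_closed])
    moreover have "mconst (1 / (d i - d j)) * mconst (d i - d j) = 1"
      using that by (simp add: mconst.hom_mult[symmetric])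
    ultimately show ?thesis by (simp add: mult.assoc[symmetric])
  qed
  \<comment> \<open>\<open>to_x\<close> rewrites a polynomial in eigencoordinates, with
    \<open>mvar k\<close> standing for the coordinate \<open>x k\<close>, so that its monomials can
    be inspected; \<open>of_x\<close> substitutes the linear forms back.\<close>
  define to_x where "to_x = mpoly_eval mconst (\<lambda>k. lform r (\<lambda>l. P $$ (k, l)))"
  define of_x where "of_x = mpoly_eval mconst x"
  have hom_to_x: "comm_ring_hom to_x" and hom_of_x: "comm_ring_hom of_x"
    unfolding to_x_def of_x_def by (rule mpoly_subst.eval.comm_ring_hom_axioms)+
  have of_to: "of_x (to_x p) = p" if p: "p \<in> carrier (mpoly_ring r)" for p
  proof (rule mpoly_homs_eqI[OF _ _ p, of "\<lambda>p. of_x (to_x p)" "\<lambda>p. p"])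
    interpret comm_ring_hom to_x by (rule hom_to_x)
    interpret of_x: comm_ring_hom of_x by (rule hom_of_x)
    show "comm_ring_hom (\<lambda>p. of_x (to_x p))"
      by unfold_locales (simp_all add: hom_add hom_mult of_x.hom_add of_x.hom_mult)
    show "comm_ring_hom (\<lambda>p::'a mpol. p)" by unfold_locales auto
    fix i assume i: "i < r"
    have "of_x (to_x (mvar i)) = (\<Sum>k<r. mconst (P $$ (i, k)) * x k)"
      by (simp add: to_x_def of_x_def mpoly_subst.eval_lform)
    also have "\<dots> = lform r (\<lambda>l. (P * Q) $$ (i, l))"
      unfolding x_def sum_mult_lform using P Q i
      by (intro lform_cong) (simp add: scalar_prod_def atLeast0LessThan)
    also have "\<dots> = lform r (\<lambda>l. if l = i then 1 else 0)"
      unfolding PQ using i by (intro lform_cong) auto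
    finally show "of_x (to_x (mvar i)) = mvar i" using lform_unit[OF i, where 'a='a] by simp
  qed (simp_all add: to_x_def of_x_def)
  have main: "f \<in> ?I" if f: "f \<in> carrier (mpoly_ring r)" and pow: "f ^ n \<in> ?I" for f n
  proof -
    have to_x_f: "to_x f \<in> carrier (mpoly_ring r)"
      unfolding to_x_def by (rule mpoly_subst_closed[OF f lform_closed])
    have vanish: "mpoly_eval mconst (\<lambda>l. if d l = c then mvar l else 0) (to_x f) = 0" for c
    proof -
      \<comment> \<open>The columns of \<open>P\<close> with \<open>d l = c\<close> parametrize the
        eigenspace of \<open>c\<close>, and \<open>pr\<close> restricts polynomials to it. There
        \<open>A x = c x\<close>, so \<open>pr\<close> kills the minors; as its target is a domain,
        a vanishing power of \<open>pr f\<close> forces \<open>pr f = 0\<close>.\<close>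
      define pr where "pr = mpoly_eval mconst (\<lambda>k. lform r (\<lambda>l. if d l = c then P $$ (k, l) else 0))"
      interpret pr: comm_ring_hom pr unfolding pr_def by (rule mpoly_subst.eval.comm_ring_hom_axioms)
      have "pr (Ax i) = mconst c * pr (mvar i)" if "i < r" for i
      proof -
        have "pr (Ax i) = lform r (\<lambda>l. \<Sum>k<r. A $$ (i, k) * (if d l = c then P $$ (k, l) else 0))"
          by (simp add: pr_def mpoly_subst.eval_lform sum_mult_lform)
        also have "\<dots> = lform r (\<lambda>l. c * (if d l = c then P $$ (i, l) else 0))"
          using that by (intro lform_cong) (auto simp: AP)
        finally show ?thesis by (simp add: pr_def mult_lform)
      qed
      then have "0 dvd pr (eigen_minor r A i j)" if "i < j" "j < r" for i j
        using that by (simp add: eigen_minor_def pr.hom_minus pr.hom_mult)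
      from eigen_ideal_dvd_hom[OF pr.comm_ring_hom_axioms this pow] have "pr f = 0"
        by (simp add: pr.hom_power)
      moreover have "mpoly_eval mconst (\<lambda>l. if d l = c then mvar l else 0) (to_x f) = pr f"
      proof (rule mpoly_homs_eqI[OF _ _ f, of "\<lambda>p. mpoly_eval mconst (\<lambda>l. if d l = c then mvar l else 0) (to_x p)" pr])
        interpret comm_ring_hom to_x by (rule hom_to_x)
        show "comm_ring_hom (\<lambda>p. mpoly_eval mconst (\<lambda>l. if d l = c then mvar l else 0) (to_x p))"
          by unfold_locales (simp_all add: hom_add hom_mult mpoly_subst.eval.hom_add mpoly_subst.eval.hom_mult)
        show "comm_ring_hom pr" by (rule pr.comm_ring_hom_axioms)
        show "mpoly_eval mconst (\<lambda>l. if d l = c then mvar l else 0) (to_x (mvar i)) = pr (mvar i)" for i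
          by (simp add: to_x_def pr_def mpoly_subst.eval_lform) (auto simp: lform_def intro!: sum.cong)
      qed (simp_all add: to_x_def pr_def)
      ultimately show ?thesis by simp
    qed
    have "of_x (Poly_Mapping.single m (Poly_Mapping.lookup (to_x f) m)) \<in> ?I"
      if m: "m \<in> Poly_Mapping.keys (to_x f)" for m
    proof -
      \<comment> \<open>Any \<open>c\<close> in \<open>vanish\<close> yields some variable
        \<open>i\<close> of \<open>m\<close>, even a \<open>c\<close> that is no eigenvalue. Taking
        \<open>c = d i\<close> afterwards yields a variable \<open>j\<close> with a different
        eigenvalue.\<close>
      obtain i where i: "i \<in> Poly_Mapping.keys m"
        using mpoly_eval_restrict_vars_eq_0D[OF vanish m] by blast
      obtain j where j: "j \<in> Poly_Mapping.keys m" "d j \<noteq> d i"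
        using mpoly_eval_restrict_vars_eq_0D[OF vanish m] by blast
      have lt: "i < r" "j < r" using i j m to_x_f by (auto simp: mpoly_ring_def)
      let ?e = "Poly_Mapping.lookup m"
      have pos: "x l ^ ?e l = x l ^ (?e l - 1) * x l" if "l \<in> Poly_Mapping.keys m" for l
        using that by (cases "?e l") (auto simp: in_keys_iff)
      have "(\<Prod>l\<in>Poly_Mapping.keys m. x l ^ ?e l) =
          x i ^ ?e i * (x j ^ ?e j * (\<Prod>l\<in>Poly_Mapping.keys m - {i} - {j}. x l ^ ?e l))"
        using i j by (subst prod.remove[of _ i], simp, simp, subst prod.remove[of _ j]) auto
      also have "\<dots> = (x i ^ (?e i - 1) * x j ^ (?e j - 1) *
          (\<Prod>l\<in>Poly_Mapping.keys m - {i} - {j}. x l ^ ?e l)) * (x i * x j)"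
        unfolding pos[OF i] pos[OF j(1)] by (simp only: mult_ac)
      finally have "of_x (Poly_Mapping.single m (Poly_Mapping.lookup (to_x f) m)) =
          (mconst (Poly_Mapping.lookup (to_x f) m) * (x i ^ (?e i - 1) * x j ^ (?e j - 1) *
          (\<Prod>l\<in>Poly_Mapping.keys m - {i} - {j}. x l ^ ?e l))) * (x i * x j)"
        by (simp add: of_x_def mpoly_subst.eval_single mult.assoc)
      also have "\<dots> \<in> ?I"
        by (rule ideal_mpoly_ring_mult[OF ideal_eigen_ideal xx[OF lt not_sym[OF j(2)]]])
          (auto intro!: mpoly_ring_closed x_closed)
      finally show ?thesis .
    qed
    then have "of_x (\<Sum>m\<in>Poly_Mapping.keys (to_x f). Poly_Mapping.single m (Poly_Mapping.lookup (to_x f) m)) \<in> ?I"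
      unfolding of_x_def mpoly_subst.eval_sum by (intro ideal_mpoly_ring_sum[OF ideal_eigen_ideal])
    then show ?thesis by (simp add: poly_mapping_sum_monomials of_to[OF f])
  qed
  show ?thesis unfolding radical_ideal_def using ideal_eigen_ideal main by simp
qed

section \<open>Nilpotent sections of Proj\<close>

text \<open>Homogeneous localization computes with products of homogeneous elements. These axioms
  capture that aspect of a grading and pass to a quotient through coset representatives.\<close>

locale multiplicative_grading = cring R for R :: "('s, 'm) ring_scheme" (structure) +
  fixes gr :: "nat \<Rightarrow> 's set"
  assumes gr_carrier: "gr d \<subseteq> carrier R"
    and gr_one: "\<one> \<in> gr 0"
    and gr_zero: "\<zero> \<in> gr d"
    and gr_mult: "a \<in> gr d \<Longrightarrow> b \<in> gr e \<Longrightarrow> a \<otimes> b \<in> gr (d + e)"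
begin

lemma grD: "a \<in> gr d \<Longrightarrow> a \<in> carrier R"
  using gr_carrier by blast

end

locale graded_localization = multiplicative_grading R gr + primeideal p R
  for R :: "('s, 'm) ring_scheme" (structure) and gr p
begin

lemma notin_mult: "a \<in> carrier R \<Longrightarrow> b \<in> carrier R \<Longrightarrow> a \<notin> p \<Longrightarrow> b \<notin> p \<Longrightarrow> a \<otimes> b \<notin> p"
  using I_prime by blast

lemma one_notin: "\<one> \<notin> p"
  using I_notcarr one_imp_carrier by blast

lemma pairsI: "a \<in> gr d \<Longrightarrow> f \<in> gr d \<Longrightarrow> f \<notin> p \<Longrightarrow> (a, f) \<in> hfrac_pairs gr p"
  by (auto simp: hfrac_pairs_def)

lemma pairsE:
  assumes "(a, f) \<in> hfrac_pairs gr p"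
  obtains d where "a \<in> gr d" "f \<in> gr d" "f \<notin> p" "a \<in> carrier R" "f \<in> carrier R"
  using assms grD by (auto simp: hfrac_pairs_def)

definition heq :: "'s \<Rightarrow> 's \<Rightarrow> 's \<Rightarrow> 's \<Rightarrow> bool" where
  "heq a f b g \<longleftrightarrow> (\<exists>t\<in>(\<Union>d. gr d) - p. t \<otimes> (a \<otimes> g) = t \<otimes> (b \<otimes> f))"

lemma heq_trans:
  assumes "(a, f) \<in> hfrac_pairs gr p" "(b, g) \<in> hfrac_pairs gr p" "(c, h) \<in> hfrac_pairs gr p"
    and "heq a f b g" "heq b g c h"
  shows "heq a f c h"
proof -
  from assms obtain da where a: "a \<in> gr da" "f \<in> gr da" "f \<notin> p" "a \<in> carrier R" "f \<in> carrier R"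
    by (auto elim: pairsE)
  from assms obtain db where b: "b \<in> gr db" "g \<in> gr db" "g \<notin> p" "b \<in> carrier R" "g \<in> carrier R"
    by (auto elim: pairsE)
  from assms obtain dc where c: "c \<in> gr dc" "h \<in> gr dc" "h \<notin> p" "c \<in> carrier R" "h \<in> carrier R"
    by (auto elim: pairsE)
  obtain s ds where s: "s \<in> gr ds" "s \<notin> p" "s \<otimes> (a \<otimes> g) = s \<otimes> (b \<otimes> f)" "s \<in> carrier R"
    using assms(4) grD unfolding heq_def by blast
  obtain t dt where t: "t \<in> gr dt" "t \<notin> p" "t \<otimes> (b \<otimes> h) = t \<otimes> (c \<otimes> g)" "t \<in> carrier R"
    using assms(5) grD unfolding heq_def by blast
  \<comment> \<open>Besides the two witnesses, the middle denominator \<open>g\<close> enters: it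
    links \<open>a h\<close> to \<open>c f\<close> by way of \<open>b\<close>. Primality keeps the
    product outside \<open>p\<close>.\<close>
  let ?u = "s \<otimes> t \<otimes> g"
  have "?u \<in> gr (ds + dt + db)" using s t b by (intro gr_mult)
  moreover have "?u \<notin> p" using s t b by (intro notin_mult) auto
  moreover have "?u \<otimes> (a \<otimes> h) = ?u \<otimes> (c \<otimes> f)"
  proof -
    note carr = s(4) t(4) a(4,5) b(4,5) c(4,5)
    have "?u \<otimes> (a \<otimes> h) = (s \<otimes> (a \<otimes> g)) \<otimes> (t \<otimes> h)"
      using carr by (simp add: m_ac)
    also have "\<dots> = (s \<otimes> f) \<otimes> (t \<otimes> (b \<otimes> h))"
      unfolding s(3) using carr by (simp add: m_ac)
    also have "\<dots> = ?u \<otimes> (c \<otimes> f)"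
      unfolding t(3) using carr by (simp add: m_ac)
    finally show ?thesis .
  qed
  ultimately show ?thesis unfolding heq_def by blast
qed

lemma heq_sym: "heq a f b g \<Longrightarrow> heq b g a f"
  unfolding heq_def by (elim bexE) (rule bexI, rule sym)

lemma heq_refl: "heq a f a f"
  unfolding heq_def using gr_one one_notin by blast

lemma hfrac_altdef: "hfrac R gr p a f = {(b, g)\<in>hfrac_pairs gr p. heq a f b g}"
  by (simp add: hfrac_def heq_def)

lemma hfrac_eq_iff:
  assumes "(a, f) \<in> hfrac_pairs gr p" "(b, g) \<in> hfrac_pairs gr p"
  shows "hfrac R gr p a f = hfrac R gr p b g \<longleftrightarrow> heq a f b g"
proof
  assume "hfrac R gr p a f = hfrac R gr p b g"
  then show "heq a f b g" using assms heq_refl[of b g] by (auto simp: hfrac_altdef)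
next
  assume "heq a f b g"
  then show "hfrac R gr p a f = hfrac R gr p b g"
    unfolding hfrac_altdef using assms heq_trans heq_sym by blast
qed

lemma hfrac_eq_0_iff:
  assumes "(a, f) \<in> hfrac_pairs gr p"
  shows "hfrac R gr p a f = hfrac R gr p \<zero> \<one> \<longleftrightarrow> (\<exists>t\<in>(\<Union>d. gr d) - p. t \<otimes> a = \<zero>)"
proof -
  have zo: "(\<zero>, \<one>) \<in> hfrac_pairs gr p" using gr_zero gr_one one_notin by (intro pairsI)
  have "a \<in> carrier R" "f \<in> carrier R" using assms by (auto elim: pairsE)
  then show ?thesis
    unfolding hfrac_eq_iff[OF assms zo] heq_def using grD by (intro bex_cong) auto
qed

lemma heq_mult:
  assumes "(a, f) \<in> hfrac_pairs gr p" "(b, g) \<in> hfrac_pairs gr p"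
    and "(a', f') \<in> hfrac_pairs gr p" "(b', g') \<in> hfrac_pairs gr p"
    and "heq a f a' f'" "heq b g b' g'"
  shows "heq (a \<otimes> b) (f \<otimes> g) (a' \<otimes> b') (f' \<otimes> g')"
proof -
  have c: "a \<in> carrier R" "f \<in> carrier R" "b \<in> carrier R" "g \<in> carrier R"
    "a' \<in> carrier R" "f' \<in> carrier R" "b' \<in> carrier R" "g' \<in> carrier R"
    using assms(1-4) by (auto elim: pairsE)
  obtain s ds where s: "s \<in> gr ds" "s \<notin> p" "s \<otimes> (a \<otimes> f') = s \<otimes> (a' \<otimes> f)" "s \<in> carrier R"
    using assms(5) grD unfolding heq_def by blast
  obtain t dt where t: "t \<in> gr dt" "t \<notin> p" "t \<otimes> (b \<otimes> g') = t \<otimes> (b' \<otimes> g)" "t \<in> carrier R"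
    using assms(6) grD unfolding heq_def by blast
  have "(s \<otimes> t) \<otimes> ((a \<otimes> b) \<otimes> (f' \<otimes> g')) = (s \<otimes> (a \<otimes> f')) \<otimes> (t \<otimes> (b \<otimes> g'))"
    using s(4) t(4) c by (simp add: m_ac)
  also have "\<dots> = (s \<otimes> t) \<otimes> ((a' \<otimes> b') \<otimes> (f \<otimes> g))"
    unfolding s(3) t(3) using s(4) t(4) c by (simp add: m_ac)
  finally have "(s \<otimes> t) \<otimes> ((a \<otimes> b) \<otimes> (f' \<otimes> g')) = (s \<otimes> t) \<otimes> ((a' \<otimes> b') \<otimes> (f \<otimes> g))" .
  moreover have "s \<otimes> t \<in> gr (ds + dt)" "s \<otimes> t \<notin> p"
    using s t by (auto intro: gr_mult dest: I_prime)
  ultimately show ?thesis unfolding heq_def by blast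
qed

lemma pairs_mult:
  assumes "(a, f) \<in> hfrac_pairs gr p" "(b, g) \<in> hfrac_pairs gr p"
  shows "(a \<otimes> b, f \<otimes> g) \<in> hfrac_pairs gr p"
  using assms by (auto elim!: pairsE intro!: pairsI gr_mult dest: I_prime)

text \<open>The product is defined as a union over all representatives. By \<open>heq_mult\<close>
  all its members are the same class, and since the factors are nonempty the union collapses to that
  class.\<close>

lemma hfrac_mult:
  assumes "(a, f) \<in> hfrac_pairs gr p" "(b, g) \<in> hfrac_pairs gr p"
  shows "hfrac R gr p a f \<otimes>\<^bsub>hlocalization R gr p\<^esub> hfrac R gr p b g = hfrac R gr p (a \<otimes> b) (f \<otimes> g)"
proof -
  have "hfrac R gr p (a' \<otimes> b') (f' \<otimes> g') = hfrac R gr p (a \<otimes> b) (f \<otimes> g)"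
    if "(a', f') \<in> hfrac R gr p a f" "(b', g') \<in> hfrac R gr p b g" for a' f' b' g'
    using that assms by (subst hfrac_eq_iff) (auto simp: hfrac_altdef intro!: pairs_mult heq_sym[OF heq_mult])
  moreover have "hfrac R gr p a f \<noteq> {}" "hfrac R gr p b g \<noteq> {}"
    using assms heq_refl by (auto simp: hfrac_altdef)
  ultimately show ?thesis
    unfolding hlocalization_def monoid.simps by (intro SUP_eq_const) (auto simp del: UN_iff UN_simps)
qed

lemma hfrac_pow:
  assumes "(a, f) \<in> hfrac_pairs gr p"
  shows "hfrac R gr p a f [^]\<^bsub>hlocalization R gr p\<^esub> (n::nat) = hfrac R gr p (a [^] n) (f [^] n)"
    and "(a [^] n, f [^] n) \<in> hfrac_pairs gr p"
proof (induction n)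
  case 0
  show "hfrac R gr p a f [^]\<^bsub>hlocalization R gr p\<^esub> (0::nat) = hfrac R gr p (a [^] (0::nat)) (f [^] (0::nat))"
    by (simp add: nat_pow_def hlocalization_def)
  show "(a [^] (0::nat), f [^] (0::nat)) \<in> hfrac_pairs gr p"
    using gr_one one_notin by (auto intro: pairsI)
next
  case (Suc n)
  have pow: "x [^]\<^bsub>hlocalization R gr p\<^esub> Suc n = x [^]\<^bsub>hlocalization R gr p\<^esub> n \<otimes>\<^bsub>hlocalization R gr p\<^esub> x" for x
    by (simp add: nat_pow_def)
  show "hfrac R gr p a f [^]\<^bsub>hlocalization R gr p\<^esub> Suc n = hfrac R gr p (a [^] Suc n) (f [^] Suc n)"
    unfolding pow using Suc assms by (simp add: hfrac_mult)
  show "(a [^] Suc n, f [^] Suc n) \<in> hfrac_pairs gr p"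
    using Suc assms by (simp add: pairs_mult)
qed

lemma reduced_hlocalization:
  assumes "reduced_ring R"
  shows "reduced_ring (hlocalization R gr p)"
  unfolding reduced_ring_def
proof (intro ballI allI impI)
  fix x and n :: nat
  assume "x \<in> carrier (hlocalization R gr p)" and pow: "x [^]\<^bsub>hlocalization R gr p\<^esub> n = \<zero>\<^bsub>hlocalization R gr p\<^esub>"
  then obtain a f where x: "x = hfrac R gr p a f" and af: "(a, f) \<in> hfrac_pairs gr p"
    by (auto simp: hlocalization_def)
  have zero: "\<zero>\<^bsub>hlocalization R gr p\<^esub> = hfrac R gr p \<zero> \<one>" by (simp add: hlocalization_def)
  have a: "a \<in> carrier R" using af by (auto elim: pairsE)
  obtain t where t: "t \<in> (\<Union>d. gr d) - p" "t \<otimes> a [^] n = \<zero>"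
    using pow hfrac_pow(2)[OF af] unfolding x hfrac_pow(1)[OF af] zero by (auto simp: hfrac_eq_0_iff)
  have tc: "t \<in> carrier R" using t grD by auto
  \<comment> \<open>The exponent \<open>Suc n\<close> leaves a spare factor \<open>a\<close> and so
    treats \<open>n = 0\<close> together with the other cases.\<close>
  have "(t \<otimes> a) [^] Suc n = (t [^] n \<otimes> a) \<otimes> (t \<otimes> a [^] n)"
    using tc a by (simp add: nat_pow_distrib m_ac)
  also have "\<dots> = \<zero>" using t tc a by simp
  finally have "t \<otimes> a = \<zero>" using assms tc a unfolding reduced_ring_def by blast
  then show "x = \<zero>\<^bsub>hlocalization R gr p\<^esub>" unfolding x zero hfrac_eq_0_iff[OF af] using t by blast
qed

end

context multiplicative_grading
begin

lemma graded_localization: "p \<in> proj_points R gr \<Longrightarrow> graded_localization R gr p"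
  unfolding proj_points_def graded_localization_def by (simp add: multiplicative_grading_axioms)

lemma openin_subset_proj_points: "openin (proj_topology R gr) U \<Longrightarrow> U \<subseteq> proj_points R gr"
  using openin_proj_topology[OF ring_axioms, of gr U] by auto

lemma proj_sections_pow_apply:
  "p \<in> U \<Longrightarrow> (s [^]\<^bsub>proj_sections R gr U\<^esub> (n::nat)) p = s p [^]\<^bsub>hlocalization R gr p\<^esub> n"
  by (induction n) (simp_all add: nat_pow_def proj_sections_def)

lemma proj_sections_pow_extensional:
  "s [^]\<^bsub>proj_sections R gr U\<^esub> (n::nat) \<in> extensional U"
  by (cases n) (simp_all add: nat_pow_def proj_sections_def)

lemma proj_sections_pow_eq_0_iff:
  "s [^]\<^bsub>proj_sections R gr U\<^esub> (n::nat) = \<zero>\<^bsub>proj_sections R gr U\<^esub> \<longleftrightarrow>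
    (\<forall>p\<in>U. s p [^]\<^bsub>hlocalization R gr p\<^esub> n = \<zero>\<^bsub>hlocalization R gr p\<^esub>)" (is "?l \<longleftrightarrow> ?r")
proof
  assume ?l
  show ?r
  proof
    fix p assume "p \<in> U"
    then show "s p [^]\<^bsub>hlocalization R gr p\<^esub> n = \<zero>\<^bsub>hlocalization R gr p\<^esub>"
      using fun_cong[OF \<open>?l\<close>, of p] by (simp add: proj_sections_pow_apply) (simp add: proj_sections_def)
  qed
next
  assume ?r
  show ?l
  proof (rule extensionalityI[OF proj_sections_pow_extensional])
    show "\<zero>\<^bsub>proj_sections R gr U\<^esub> \<in> extensional U" by (simp add: proj_sections_def)
  qed (use \<open>?r\<close> in \<open>simp add: proj_sections_pow_apply, simp add: proj_sections_def\<close>)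
qed

theorem reduced_Proj:
  assumes "reduced_ring R"
  shows "reduced_scheme (Proj R gr)"
  unfolding reduced_scheme_def
proof (intro allI impI)
  fix U assume "openin (rs_top (Proj R gr)) U"
  then have U: "U \<subseteq> proj_points R gr" using openin_subset_proj_points by (simp add: Proj_def)
  have "reduced_ring (proj_sections R gr U)"
    unfolding reduced_ring_def
  proof (intro ballI allI impI)
    fix s and n :: nat
    assume "s \<in> carrier (proj_sections R gr U)"
      and pow: "s [^]\<^bsub>proj_sections R gr U\<^esub> n = \<zero>\<^bsub>proj_sections R gr U\<^esub>"
    then have s: "s \<in> (\<Pi>\<^sub>E p\<in>U. carrier (hlocalization R gr p))"
      by (simp add: proj_sections_def proj_section_set_def)
    show "s = \<zero>\<^bsub>proj_sections R gr U\<^esub>"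
    proof (rule extensionalityI[of s U])
      show "\<zero>\<^bsub>proj_sections R gr U\<^esub> \<in> extensional U" by (simp add: proj_sections_def)
      fix p assume p: "p \<in> U"
      then interpret graded_localization R gr p using U graded_localization by blast
      have "s p = \<zero>\<^bsub>hlocalization R gr p\<^esub>"
        using reduced_hlocalization[OF assms] p s pow unfolding proj_sections_pow_eq_0_iff reduced_ring_def by blast
      then show "s p = \<zero>\<^bsub>proj_sections R gr U\<^esub> p" using p by (simp add: proj_sections_def)
    qed (use s in \<open>auto simp: PiE_def\<close>)
  qed
  then show "reduced_ring (rs_sections (Proj R gr) U)" by (simp add: Proj_def)
qed

text \<open>The section \<open>a/f\<close> over the open set where \<open>f\<close> does not vanish is nilpotent, hence zero.\<close>
lemma reduced_Proj_fraction_eq_0: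
  assumes red: "reduced_scheme (Proj R gr)" and a: "a \<in> gr d" and f: "f \<in> gr d"
    and nil: "f \<otimes> a [^] (n::nat) = \<zero>" and p: "p \<in> proj_points R gr" "f \<notin> p"
  shows "\<exists>t\<in>(\<Union>d. gr d) - p. t \<otimes> a = \<zero>"
proof -
  define U where "U = {q\<in>proj_points R gr. f \<notin> q}"
  have U: "openin (proj_topology R gr) U"
    unfolding openin_proj_topology[OF ring_axioms] U_def using grD[OF f]
    by (intro exI[of _ "{f}"]) auto
  define s where "s = (\<lambda>q\<in>U. hfrac R gr q a f)"
  have loc: "graded_localization R gr q" "(a, f) \<in> hfrac_pairs gr q" if "q \<in> U" for q
    using that a f graded_localization by (auto simp: U_def hfrac_pairs_def)
  have "s \<in> carrier (proj_sections R gr U)"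
  proof -
    have "s \<in> (\<Pi>\<^sub>E p\<in>U. carrier (hlocalization R gr p))"
      using loc(2) by (auto simp: s_def hlocalization_def)
    moreover have "\<forall>q\<in>U. f \<notin> q \<and> s q = hfrac R gr q a f" by (auto simp: s_def U_def)
    ultimately show ?thesis using U a f by (auto simp: proj_sections_def proj_section_set_def)
  qed
  moreover have "s [^]\<^bsub>proj_sections R gr U\<^esub> n = \<zero>\<^bsub>proj_sections R gr U\<^esub>"
    unfolding proj_sections_pow_eq_0_iff
  proof
    fix q assume q: "q \<in> U"
    interpret graded_localization R gr q by (rule loc(1)[OF q])
    \<comment> \<open>As \<open>f\<close> lies outside \<open>q\<close>, it is itself the
      homogeneous witness that annihilates the numerator \<open>a [^] n\<close>.\<close>
    show "s q [^]\<^bsub>hlocalization R gr q\<^esub> n = \<zero>\<^bsub>hlocalization R gr q\<^esub>"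
      using q f nil hfrac_pow[OF loc(2)[OF q], of n] hfrac_eq_0_iff[OF hfrac_pow(2)[OF loc(2)[OF q]], of n]
      by (auto simp: s_def U_def hlocalization_def)
  qed
  moreover have "reduced_ring (proj_sections R gr U)"
    using red U by (simp add: reduced_scheme_def Proj_def)
  ultimately have s0: "s = \<zero>\<^bsub>proj_sections R gr U\<^esub>"
    unfolding reduced_ring_def by blast
  have pU: "p \<in> U" using p by (simp add: U_def)
  interpret graded_localization R gr p by (rule loc(1)[OF pU])
  have "s p = hfrac R gr p \<zero> \<one>" unfolding s0 using pU by (simp add: proj_sections_def hlocalization_def)
  then show ?thesis using pU by (simp add: s_def hfrac_eq_0_iff[OF loc(2)[OF pU]])
qed

end

section \<open>Closed subschemes of projective space\<close>

lemma mono_degree_superset: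
  "finite K \<Longrightarrow> Poly_Mapping.keys m \<subseteq> K \<Longrightarrow> mono_degree m = (\<Sum>i\<in>K. Poly_Mapping.lookup m i)"
  unfolding mono_degree_def by (intro sum.mono_neutral_left) (auto simp: in_keys_iff)

lemma mono_degree_add: "mono_degree (a + b) = mono_degree a + mono_degree b"
proof -
  let ?K = "Poly_Mapping.keys a \<union> Poly_Mapping.keys b"
  have "mono_degree m = (\<Sum>i\<in>?K. Poly_Mapping.lookup m i)" if "m \<in> {a, b, a + b}" for m
    using that Poly_Mapping.keys_add[of a b] by (intro mono_degree_superset) auto
  from this[of a] this[of b] this[of "a + b"] show ?thesis
    by (simp add: lookup_add sum.distrib)
qed

lemma mpoly_grading_mult:
  assumes "p \<in> mpoly_grading r d" "q \<in> mpoly_grading r e"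
  shows "p * q \<in> mpoly_grading r (d + e)"
  using assms Poly_Mapping.keys_mult[of p q] mpoly_ring_mult_closed[of p r q]
  by (force simp: mpoly_grading_def mono_degree_add)

lemma mpoly_grading_add:
  assumes "p \<in> mpoly_grading r d" "q \<in> mpoly_grading r d"
  shows "p + q \<in> mpoly_grading r d"
  using assms Poly_Mapping.keys_add[of p q] mpoly_ring_add_closed[of p r q]
  by (auto simp: mpoly_grading_def)

lemma mpoly_grading_zero: "0 \<in> mpoly_grading r d"
  by (simp add: mpoly_grading_def mpoly_ring_zero_closed)

lemma mpoly_grading_one: "1 \<in> mpoly_grading r 0"
  by (simp add: mpoly_grading_def mpoly_ring_one_closed mono_degree_def)

lemma mpoly_grading_uminus: "p \<in> mpoly_grading r d \<Longrightarrow> - p \<in> mpoly_grading r d"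
  by (simp add: mpoly_grading_def mpoly_ring_uminus_closed)

lemma mpoly_grading_diff:
  "p \<in> mpoly_grading r d \<Longrightarrow> q \<in> mpoly_grading r d \<Longrightarrow> p - q \<in> mpoly_grading r d"
  using mpoly_grading_add[OF _ mpoly_grading_uminus, of p r d q] by simp

lemma mpoly_grading_mconst: "mconst c \<in> mpoly_grading r 0"
  using mpoly_ring_mconst_closed[of c r]
  by (auto simp: mpoly_grading_def mconst_def mono_degree_def split: if_splits)

lemma mpoly_grading_mvar: "i < r \<Longrightarrow> mvar i \<in> mpoly_grading r 1"
  by (simp add: mpoly_grading_def mpoly_ring_mvar_closed) (simp add: mvar_def mono_degree_def)

lemma mpoly_grading_sum: "(\<And>x. x \<in> S \<Longrightarrow> f x \<in> mpoly_grading r d) \<Longrightarrow> sum f S \<in> mpoly_grading r d"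
  by (induction S rule: infinite_finite_induct) (auto intro: mpoly_grading_zero mpoly_grading_add)

lemma mpoly_grading_prod:
  "finite S \<Longrightarrow> (\<And>x. x \<in> S \<Longrightarrow> f x \<in> mpoly_grading r 1) \<Longrightarrow> prod f S \<in> mpoly_grading r (card S)"
  by (induction S rule: finite_induct)
    (use mpoly_grading_mult[of _ r 1] in \<open>auto intro: mpoly_grading_one\<close>)

lemma mpoly_grading_power: "p \<in> mpoly_grading r 1 \<Longrightarrow> p ^ n \<in> mpoly_grading r n"
  using mpoly_grading_prod[of "{..<n}" "\<lambda>_. p" r] by simp

lemma mpoly_grading_lform: "lform r c \<in> mpoly_grading r 1"
  unfolding lform_def
  by (intro mpoly_grading_sum) (use mpoly_grading_mult[OF mpoly_grading_mconst mpoly_grading_mvar] in force)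

definition hom_component :: "nat \<Rightarrow> 'a::comm_ring_1 mpol \<Rightarrow> 'a mpol" where
  "hom_component d p = (\<Sum>m\<in>{m\<in>Poly_Mapping.keys p. mono_degree m = d}. Poly_Mapping.single m (Poly_Mapping.lookup p m))"

lemma hom_component_grading:
  "p \<in> carrier (mpoly_ring r) \<Longrightarrow> hom_component d p \<in> mpoly_grading r d"
  unfolding hom_component_def
  by (intro mpoly_grading_sum) (auto simp: mpoly_grading_def mpoly_ring_def)

lemma sum_hom_components: "(\<Sum>d\<in>mono_degree ` Poly_Mapping.keys p. hom_component d p) = p"
  unfolding hom_component_def
  by (subst sum.image_gen[symmetric]) (simp_all add: poly_mapping_sum_monomials)

locale mpoly_quotient =
  fixes r :: nat and I :: "'a::idom mpol set"
  assumes ideal_I: "ideal I (mpoly_ring r)"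
begin

abbreviation "cst f \<equiv> I +>\<^bsub>mpoly_ring r\<^esub> f"
abbreviation "Q \<equiv> mpoly_ring r Quot I"
abbreviation "qgr d \<equiv> (\<lambda>f. cst f) ` mpoly_grading r d"

sublocale ideal I "mpoly_ring r" by (rule ideal_I)

lemma cring_Q: "cring Q"
  by (rule quotient_is_cring) (rule cring_mpoly_ring)

sublocale Q: cring Q by (rule cring_Q)

lemma carrier_Q: "carrier Q = (\<lambda>f. cst f) ` carrier (mpoly_ring r)"
  by (auto simp: FactRing_def A_RCOSETS_def' a_r_coset_def)

lemma coset_hom: "ring_hom_ring (mpoly_ring r) Q (\<lambda>f. cst f)"
  using rcos_ring_hom_ring by simp

lemma coset_closed: "f \<in> carrier (mpoly_ring r) \<Longrightarrow> cst f \<in> carrier Q"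
  by (simp add: carrier_Q)

lemma coset_mult: "f \<in> carrier (mpoly_ring r) \<Longrightarrow> g \<in> carrier (mpoly_ring r) \<Longrightarrow> cst f \<otimes>\<^bsub>Q\<^esub> cst g = cst (f * g)"
  using ring_hom_mult[OF rcos_ring_hom, of f g] by simp

lemma coset_one: "\<one>\<^bsub>Q\<^esub> = cst 1"
  using ring_hom_one[OF rcos_ring_hom] by simp

lemma coset_zero: "\<zero>\<^bsub>Q\<^esub> = cst 0"
  using mpoly_ring.a_rcos_zero[OF ideal_I] ideal_mpoly_ring_zero[OF ideal_I] by (simp add: FactRing_def)

lemma coset_power: "f \<in> carrier (mpoly_ring r) \<Longrightarrow> cst f [^]\<^bsub>Q\<^esub> (n::nat) = cst (f ^ n)"
  by (induction n) (simp_all add: coset_one coset_mult mpoly_ring_power_closed mult.commute)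

lemma coset_eq_iff:
  assumes "f \<in> carrier (mpoly_ring r)" "g \<in> carrier (mpoly_ring r)"
  shows "cst f = cst g \<longleftrightarrow> f - g \<in> I"
  using mpoly_ring.quotient_eq_iff_same_a_r_cos[OF ideal_I assms] assms by (simp add: a_minus_def)

lemma coset_eq_0_iff: "f \<in> carrier (mpoly_ring r) \<Longrightarrow> cst f = \<zero>\<^bsub>Q\<^esub> \<longleftrightarrow> f \<in> I"
  unfolding coset_zero by (simp add: coset_eq_iff mpoly_ring_zero_closed)

lemma grading_Q: "multiplicative_grading Q qgr"
proof (intro multiplicative_grading.intro cring_Q multiplicative_grading_axioms.intro)
  fix d e a b
  show "qgr d \<subseteq> carrier Q" by (auto simp: mpoly_grading_def intro: coset_closed)
  show "\<one>\<^bsub>Q\<^esub> \<in> qgr 0" unfolding coset_one using mpoly_grading_one by blast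
  show "\<zero>\<^bsub>Q\<^esub> \<in> qgr d" unfolding coset_zero using mpoly_grading_zero by blast
  assume "a \<in> qgr d" "b \<in> qgr e"
  then obtain f g where "a = cst f" "f \<in> mpoly_grading r d" "b = cst g" "g \<in> mpoly_grading r e" by blast
  moreover from this have "cst f \<otimes>\<^bsub>Q\<^esub> cst g = cst (f * g)" by (intro coset_mult) (auto simp: mpoly_grading_def)
  ultimately show "a \<otimes>\<^bsub>Q\<^esub> b \<in> qgr (d + e)" using mpoly_grading_mult[of f r d g e] by simp
qed

lemma reduced_Q_if_radical:
  assumes "radical_ideal (mpoly_ring r) I"
  shows "reduced_ring Q"
  unfolding reduced_ring_def
proof (intro ballI allI impI)
  fix x and n :: nat
  assume "x \<in> carrier Q" and pow: "x [^]\<^bsub>Q\<^esub> n = \<zero>\<^bsub>Q\<^esub>"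
  then obtain f where f: "f \<in> carrier (mpoly_ring r)" "x = cst f" by (auto simp: carrier_Q)
  then have "f ^ n \<in> I" using pow by (simp add: coset_power coset_eq_0_iff mpoly_ring_power_closed)
  then have "f \<in> I" using assms f unfolding radical_ideal_def by auto
  then show "x = \<zero>\<^bsub>Q\<^esub>" using f by (simp add: coset_eq_0_iff)
qed

lemma reduced_closed_subscheme_if_radical:
  "radical_ideal (mpoly_ring r) I \<Longrightarrow> reduced_scheme (closed_subscheme r I)"
  unfolding closed_subscheme_def
  by (rule multiplicative_grading.reduced_Proj[OF grading_Q reduced_Q_if_radical])

end

section \<open>Lines through the origin as points of Proj\<close>

lemma const_poly_hom: "comm_ring_hom (\<lambda>c. [:c:])"
  by unfold_locales (simp_all add: one_pCons)

lemmas poly_eval_hom = mpoly_eval_hom.intro[OF const_poly_hom]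

lemma point_eval_hom: "mpoly_eval_hom (\<lambda>c. c)"
  by unfold_locales auto

text \<open>Restriction to the line of all \<open>T w\<close>. Evaluating at \<open>w\<close> alone
  would in general have an inhomogeneous kernel; with the parameter \<open>T\<close>, a homogeneous
  polynomial of degree \<open>d\<close> becomes its value at \<open>w\<close> times
  \<open>T^d\<close>, and the kernel is the homogeneous prime of the projective point given by
  \<open>w \<noteq> 0\<close>.\<close>

definition line_eval :: "(nat \<Rightarrow> 'a::comm_ring_1) \<Rightarrow> 'a mpol \<Rightarrow> 'a poly" where
  "line_eval w = mpoly_eval (\<lambda>c. [:c:]) (\<lambda>j. [:0, w j:])"

lemma line_eval_hom: "comm_ring_hom (line_eval w)"
  unfolding line_eval_def by (rule mpoly_eval_hom.eval_comm_ring_hom[OF poly_eval_hom])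

lemma line_eval_single:
  "line_eval w (Poly_Mapping.single m c) =
    Polynomial.monom (mpoly_eval (\<lambda>c. c) w (Poly_Mapping.single m c)) (mono_degree m)"
proof -
  have pow: "[:0, a:] ^ k = Polynomial.monom (a ^ k) k" for a :: 'a and k
  proof -
    have "[:0, a:] = Polynomial.monom a 1" by (simp add: monom_Suc monom_0)
    then show ?thesis by (simp add: monom_power)
  qed
  have "(\<Prod>i\<in>K. [:0, w i:] ^ Poly_Mapping.lookup m i) =
      Polynomial.monom (\<Prod>i\<in>K. w i ^ Poly_Mapping.lookup m i) (\<Sum>i\<in>K. Poly_Mapping.lookup m i)" if "finite K" for K
    using that by induction (simp_all add: pow mult_monom)
  then show ?thesis
    by (simp add: line_eval_def mpoly_eval_hom.eval_single[OF poly_eval_hom] mpoly_eval_hom.eval_single[OF point_eval_hom] mono_degree_def smult_monom)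
qed

lemma line_eval_homogeneous:
  assumes "\<And>m. m \<in> Poly_Mapping.keys p \<Longrightarrow> mono_degree m = d"
  shows "line_eval w p = Polynomial.monom (mpoly_eval (\<lambda>c. c) w p) d"
proof -
  interpret comm_ring_hom "line_eval w" by (rule line_eval_hom)
  let ?s = "\<lambda>m. Poly_Mapping.single m (Poly_Mapping.lookup p m)"
  have "line_eval w (\<Sum>m\<in>Poly_Mapping.keys p. ?s m) =
      Polynomial.monom (mpoly_eval (\<lambda>c. c) w (\<Sum>m\<in>Poly_Mapping.keys p. ?s m)) d"
    using assms by (simp add: hom_sum line_eval_single mpoly_eval_hom.eval_sum[OF point_eval_hom] monom_sum)
  then show ?thesis by (simp add: poly_mapping_sum_monomials)
qed

text \<open>The exponent of \<open>T\<close> records the degree of the monomial. Hence a polynomial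
  in the kernel has all its homogeneous components in the kernel.\<close>

lemma line_eval_hom_component:
  "line_eval w (hom_component d p) = Polynomial.monom (Polynomial.coeff (line_eval w p) d) d"
proof -
  interpret comm_ring_hom "line_eval w" by (rule line_eval_hom)
  let ?s = "\<lambda>m. Poly_Mapping.single m (Poly_Mapping.lookup p m)"
  let ?c = "\<lambda>m. mpoly_eval (\<lambda>c. c) w (?s m)"
  have "Polynomial.coeff (line_eval w p) d = Polynomial.coeff (line_eval w (\<Sum>m\<in>Poly_Mapping.keys p. ?s m)) d"
    by (simp add: poly_mapping_sum_monomials)
  also have "\<dots> = (\<Sum>m\<in>Poly_Mapping.keys p. if mono_degree m = d then ?c m else 0)"
    unfolding hom_sum line_eval_single coeff_sum coeff_monom ..
  also have "\<dots> = (\<Sum>m\<in>{m\<in>Poly_Mapping.keys p. mono_degree m = d}. ?c m)"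
    by (simp add: sum.If_cases Int_def conj_commute)
  finally show ?thesis
    unfolding hom_component_def hom_sum line_eval_single by (simp add: monom_sum)
qed

context mpoly_quotient
begin

definition line_ideal :: "(nat \<Rightarrow> 'a) \<Rightarrow> 'a mpol set" where
  "line_ideal w = {f\<in>carrier (mpoly_ring r). line_eval w f = 0}"

definition line_point :: "(nat \<Rightarrow> 'a) \<Rightarrow> 'a mpol set set" where
  "line_point w = (\<lambda>f. cst f) ` line_ideal w"

lemma ideal_line_ideal: "ideal (line_ideal w) (mpoly_ring r)"
  using ideal_dvd_vimage[OF line_eval_hom, of r 0 w] by (simp add: line_ideal_def)

lemma ideal_line_point: "ideal (line_point w) Q"
  unfolding line_point_def by (rule mpoly_ring.ring_ideal_imp_quot_ideal[OF ideal_I ideal_line_ideal])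

lemma mem_line_point_iff:
  assumes I: "I \<subseteq> line_ideal w" and f: "f \<in> carrier (mpoly_ring r)"
  shows "cst f \<in> line_point w \<longleftrightarrow> line_eval w f = 0"
proof
  interpret comm_ring_hom "line_eval w" by (rule line_eval_hom)
  assume "cst f \<in> line_point w"
  then obtain g where g: "g \<in> line_ideal w" "cst f = cst g" by (auto simp: line_point_def)
  then have "f - g \<in> line_ideal w" using f I by (auto simp: coset_eq_iff line_ideal_def)
  then show "line_eval w f = 0" using g by (simp add: line_ideal_def hom_minus)
qed (use f in \<open>auto simp: line_point_def line_ideal_def\<close>)

text \<open>Prime because \<open>line_eval w\<close> maps into a domain, homogeneous because powers
  of \<open>T\<close> separate the components, and not containing the irrelevant ideal because
  \<open>mvar i\<close> does not vanish at \<open>w\<close>.\<close>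

lemma line_point_in_proj_points:
  assumes I: "I \<subseteq> line_ideal w" and i: "i < r" "w i \<noteq> 0"
  shows "line_point w \<in> proj_points Q qgr"
proof -
  interpret line: comm_ring_hom "line_eval w" by (rule line_eval_hom)
  note mem = mem_line_point_iff[OF I]
  have sub: "line_point w \<subseteq> carrier Q"
    by (auto simp: line_point_def line_ideal_def intro: coset_closed)
  have "primeideal (line_point w) Q"
  proof (rule primeidealI[OF ideal_line_point cring_Q])
    have "cst 1 \<notin> line_point w" by (simp add: mem mpoly_ring_one_closed)
    then show "carrier Q \<noteq> line_point w" using coset_closed[OF mpoly_ring_one_closed] by blast
    fix a b assume "a \<in> carrier Q" "b \<in> carrier Q" and ab: "a \<otimes>\<^bsub>Q\<^esub> b \<in> line_point w"
    then obtain f g where f: "f \<in> carrier (mpoly_ring r)" "a = cst f" and g: "g \<in> carrier (mpoly_ring r)" "b = cst g"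
      by (auto simp: carrier_Q)
    have "line_eval w f * line_eval w g = 0"
      using ab f g by (simp add: coset_mult mem mpoly_ring_mult_closed line.hom_mult)
    then show "a \<in> line_point w \<or> b \<in> line_point w"
      using f g by (auto simp: mem)
  qed
  moreover have "homogeneous_ideal Q qgr (line_point w)"
  proof -
    let ?E = "line_point w \<inter> (\<Union>d. qgr d)"
    have E: "?E \<subseteq> carrier Q" using sub by blast
    have "x \<in> Idl\<^bsub>Q\<^esub> ?E" if x: "x \<in> line_point w" for x
    proof -
      obtain f where f: "f \<in> carrier (mpoly_ring r)" "line_eval w f = 0" "x = cst f"
        using x by (auto simp: line_point_def line_ideal_def)
      \<comment> \<open>The generated ideal is pulled back to the polynomial ring, where
        \<open>f\<close> can be written as the sum of its homogeneous components.\<close>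
      let ?K = "{g\<in>carrier (mpoly_ring r). cst g \<in> Idl\<^bsub>Q\<^esub> ?E}"
      have K: "ideal ?K (mpoly_ring r)"
        by (rule ring_hom_ring.ideal_vimage[OF coset_hom Q.genideal_ideal[OF E]])
      have "hom_component d f \<in> ?K" for d
      proof -
        have gr: "hom_component d f \<in> mpoly_grading r d" by (rule hom_component_grading[OF f(1)])
        then have c: "hom_component d f \<in> carrier (mpoly_ring r)" by (simp add: mpoly_grading_def)
        have "cst (hom_component d f) \<in> ?E"
          using gr c f(2) by (auto simp: mem line_eval_hom_component)
        then show ?thesis using Q.genideal_self[OF E] c by blast
      qed
      then have "(\<Sum>d\<in>mono_degree ` Poly_Mapping.keys f. hom_component d f) \<in> ?K"
        by (rule ideal_mpoly_ring_sum[OF K])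
      then show ?thesis using f(3) by (simp add: sum_hom_components)
    qed
    moreover have "Idl\<^bsub>Q\<^esub> ?E \<subseteq> line_point w"
      by (rule Q.genideal_minimal[OF ideal_line_point]) blast
    ultimately show ?thesis unfolding homogeneous_ideal_def using ideal_line_point by blast
  qed
  moreover have "\<not> irrelevant_ideal Q qgr \<subseteq> line_point w"
  proof -
    have "(\<Union>d\<in>{0<..}. qgr d) \<subseteq> carrier Q" by (auto simp: mpoly_grading_def intro: coset_closed)
    moreover have "cst (mvar i) \<in> (\<Union>d\<in>{0<..}. qgr d)"
      by (intro UN_I[of 1] imageI mpoly_grading_mvar i(1)) simp
    ultimately have "cst (mvar i) \<in> irrelevant_ideal Q qgr"
      unfolding irrelevant_ideal_def using Q.genideal_self by blast
    moreover have "cst (mvar i) \<notin> line_point w"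
      using i by (simp add: mem mpoly_ring_mvar_closed line_eval_def mpoly_eval_hom.eval_mvar[OF poly_eval_hom])
    ultimately show ?thesis by blast
  qed
  ultimately show ?thesis unfolding proj_points_def by blast
qed

end

section \<open>Reduced eigenschemes\<close>

context eigen_ideal_context
begin

text \<open>On the chart of \<open>x_i\<close> the relation \<open>A x = \<Lambda> x\<close> gives
  \<open>q(A) x = q(\<Lambda>) x\<close> for every polynomial \<open>q\<close>. This is its
  \<open>j\<close>-th coordinate for \<open>q\<close> a product of linear factors, with denominators
  cleared by one \<open>x_i\<close> per factor.\<close>

lemma mat_poly_mod_eigen_ideal:
  assumes i: "i < r" and j: "j < r"
  shows "mvar i ^ length cs * lform r (\<lambda>k. mat_poly A (\<Prod>c\<leftarrow>cs. [:- c, 1:]) $$ (j, k))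
    - mvar j * (\<Prod>c\<leftarrow>cs. Ax i - mconst c * mvar i) \<in> eigen_ideal r A"
proof (induction cs)
  case Nil
  have "mat_poly A 1 = 1\<^sub>m r"
    using A by (auto simp: one_pCons mat_poly_pCons[OF A] mat_poly_0[OF A] intro!: eq_matI)
  then have "lform r (\<lambda>k. mat_poly A 1 $$ (j, k)) = lform r (\<lambda>k. if k = j then 1 else 0)"
    using j by (intro lform_cong) auto
  then show ?case
    using j ideal_mpoly_ring_zero[OF ideal_eigen_ideal] by (simp add: lform_unit)
next
  case (Cons c cs)
  let ?q = "\<Prod>c\<leftarrow>cs. [:- c, 1:]"
  let ?x = "mvar i ^ length cs"
  let ?F = "\<lambda>k. mat_poly A ?q $$ (j, k)"
  let ?b = "Ax i - mconst c * mvar i"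
  let ?S = "\<Sum>l<r. mconst (?F l) * Ax l"
  have "lform r (\<lambda>k. mat_poly A ([:- c, 1:] * ?q) $$ (j, k)) = lform r (\<lambda>k. (\<Sum>l<r. ?F l * A $$ (l, k)) - c * ?F k)"
    using j by (intro lform_cong mat_poly_linear_factor[OF A]) auto
  also have "\<dots> = ?S - mconst c * lform r ?F"
    by (simp only: lform_minus sum_mult_lform mult_lform[of c])
  finally have F: "lform r (\<lambda>k. mat_poly A ([:- c, 1:] * ?q) $$ (j, k)) = ?S - mconst c * lform r ?F" .
  have unit: "(\<Sum>l<r. mconst (if l = i then 1 else 0) * Ax l) = Ax i"
    using i by (simp add: if_distrib[of mconst] if_distrib[of "\<lambda>x. x * _"] cong: if_cong)
  \<comment> \<open>The general minor for two functionals: row \<open>j\<close> of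
    \<open>q(A)\<close> and the coordinate \<open>x_i\<close>.\<close>
  have 1: "?S * mvar i - Ax i * lform r ?F \<in> eigen_ideal r A"
    using general_minor_in_eigen_ideal[of ?F "\<lambda>k. if k = i then 1 else 0"] i by (simp add: lform_unit unit)
  have "?x * (?S * mvar i - Ax i * lform r ?F) +
      ?b * (?x * lform r ?F - mvar j * (\<Prod>c\<leftarrow>cs. Ax i - mconst c * mvar i)) \<in> eigen_ideal r A"
    using i by (intro ideal_mpoly_ring_add[OF ideal_eigen_ideal] ideal_mpoly_ring_mult[OF ideal_eigen_ideal] 1 Cons.IH)
      (auto intro!: mpoly_ring_closed lform_closed)
  also have "?x * (?S * mvar i - Ax i * lform r ?F) +
      ?b * (?x * lform r ?F - mvar j * (\<Prod>c\<leftarrow>cs. Ax i - mconst c * mvar i)) =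
      mvar i ^ length (c # cs) * (?S - mconst c * lform r ?F) - mvar j * (?b * (\<Prod>c\<leftarrow>cs. Ax i - mconst c * mvar i))"
    by (simp add: algebra_simps)
  finally show ?case unfolding F[symmetric] by simp
qed

lemma char_poly_product_in_eigen_ideal:
  assumes "i < r" and cs: "char_poly A = (\<Prod>c\<leftarrow>cs. [:- c, 1:])"
  shows "mvar i * (\<Prod>c\<leftarrow>cs. Ax i - mconst c * mvar i) \<in> eigen_ideal r A"
proof -
  have "lform r (\<lambda>k. mat_poly A (\<Prod>c\<leftarrow>cs. [:- c, 1:]) $$ (i, k)) = 0"
    using cayley_hamilton[OF A] assms(1) by (simp add: cs lform_def)
  with mat_poly_mod_eigen_ideal[OF assms(1,1), of cs]
  have "- (mvar i * (\<Prod>c\<leftarrow>cs. Ax i - mconst c * mvar i)) \<in> eigen_ideal r A" by simp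
  from ideal_mpoly_ring_mult[OF ideal_eigen_ideal this, of "- 1"] show ?thesis
    by (simp add: mpoly_ring_closed)
qed

text \<open>Each factor of the list divides the product over the distinct eigenvalues, so the
  exponent \<open>length cs\<close> absorbs all multiplicities. The power of \<open>mvar i\<close>
  has the degree of that product and later becomes the denominator; as \<open>cs\<close> is
  nonempty, it contains the one \<open>mvar i\<close> that the Cayley-Hamilton relation
  costs.\<close>

lemma nilpotent_fraction:
  assumes "i < r" and cs: "char_poly A = (\<Prod>c\<leftarrow>cs. [:- c, 1:])" and "set cs \<noteq> {}"
  shows "mvar i ^ card (set cs) * (\<Prod>c\<in>set cs. Ax i - mconst c * mvar i) ^ length cs \<in> eigen_ideal r A"
proof -
  let ?b = "\<lambda>c. Ax i - mconst c * mvar i"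
  have closed: "?b c \<in> carrier (mpoly_ring r)" for c
    using assms(1) by (intro mpoly_ring_closed lform_closed)
  have "\<exists>u\<in>carrier (mpoly_ring r). prod ?b S ^ length xs = u * (\<Prod>c\<leftarrow>xs. ?b c)"
    if "set xs \<subseteq> S" "finite S" for xs S
    using that(1)
  proof (induction xs)
    case Nil
    show ?case by (intro bexI[of _ 1]) (auto intro: mpoly_ring_closed)
  next
    case (Cons c xs)
    then obtain u where u: "u \<in> carrier (mpoly_ring r)" "prod ?b S ^ length xs = u * (\<Prod>c\<leftarrow>xs. ?b c)" by auto
    have rem: "prod ?b S = ?b c * prod ?b (S - {c})" using Cons.prems that(2) by (intro prod.remove) auto
    have "prod ?b S ^ length (c # xs) = prod ?b S * prod ?b S ^ length xs" by simp
    also have "\<dots> = (?b c * prod ?b (S - {c})) * (u * (\<Prod>c\<leftarrow>xs. ?b c))"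
      by (rule arg_cong2[of _ _ _ _ "(*)", OF rem u(2)])
    also have "\<dots> = (prod ?b (S - {c}) * u) * (\<Prod>c\<leftarrow>c # xs. ?b c)"
      by (simp add: mult_ac)
    finally have "prod ?b S ^ length (c # xs) = (prod ?b (S - {c}) * u) * (\<Prod>c\<leftarrow>c # xs. ?b c)" .
    moreover have "prod ?b (S - {c}) * u \<in> carrier (mpoly_ring r)"
      by (intro mpoly_ring_mult_closed mpoly_ring_prod_closed closed u(1))
    ultimately show ?case by (rule bexI)
  qed
  from this[of cs "set cs"] obtain u where u: "u \<in> carrier (mpoly_ring r)"
    "(\<Prod>c\<in>set cs. ?b c) ^ length cs = u * (\<Prod>c\<leftarrow>cs. ?b c)" by auto
  have "card (set cs) = Suc (card (set cs) - 1)" using assms(3) by (simp add: card_gt_0_iff)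
  then have x: "mvar i ^ card (set cs) = mvar i ^ (card (set cs) - 1) * (mvar i :: 'a mpol)"
    by (metis power_Suc2)
  have "mvar i ^ card (set cs) * (\<Prod>c\<in>set cs. ?b c) ^ length cs =
      (mvar i ^ (card (set cs) - 1) * u) * (mvar i * (\<Prod>c\<leftarrow>cs. ?b c))"
    unfolding x u(2) by (simp only: mult_ac)
  also have "\<dots> \<in> eigen_ideal r A"
    by (rule ideal_mpoly_ring_mult[OF ideal_eigen_ideal char_poly_product_in_eigen_ideal[OF assms(1,2)]])
      (use assms(1) u in \<open>auto intro!: mpoly_ring_closed\<close>)
  finally show ?thesis .
qed

sublocale quot: mpoly_quotient r "eigen_ideal r A"
  by (rule mpoly_quotient.intro) (rule ideal_eigen_ideal)

text \<open>On the line through an eigenvector the two columns of the matrix are proportional with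
  factor \<open>c\<close>. This makes the line a point of the eigenscheme.\<close>

lemma eigen_ideal_line_subset:
  assumes "\<And>k. k < r \<Longrightarrow> (\<Sum>l<r. A $$ (k, l) * w l) = c * w k"
  shows "eigen_ideal r A \<subseteq> quot.line_ideal w"
proof
  fix f assume f: "f \<in> eigen_ideal r A"
  interpret line: comm_ring_hom "line_eval w" by (rule line_eval_hom)
  have "line_eval w (Ax k) = [:c:] * line_eval w (mvar k)" if "k < r" for k
  proof -
    have "line_eval w (Ax k) = (\<Sum>l<r. [:0, A $$ (k, l) * w l:])"
      by (simp add: line_eval_def mpoly_eval_hom.eval_lform[OF poly_eval_hom] mult.commute)
    also have "\<dots> = [:0, \<Sum>l<r. A $$ (k, l) * w l:]"
      by (induction r) (auto)
    finally show ?thesis using assms[OF that]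
      by (simp add: line_eval_def mpoly_eval_hom.eval_mvar[OF poly_eval_hom])
  qed
  then have "0 dvd line_eval w (eigen_minor r A i j)" if "i < j" "j < r" for i j
    using that by (simp add: eigen_minor_def line.hom_minus line.hom_mult mult.commute)
  from eigen_ideal_dvd_hom[OF line_eval_hom this f] show "f \<in> quot.line_ideal w"
    using f eigen_ideal_subset by (auto simp: quot.line_ideal_def)
qed

text \<open>Restriction to \<open>w + T v\<close>. Values are taken in polynomials in
  \<open>T\<close>, and vanishing over the dual numbers is read as divisibility by
  \<open>T^2\<close>; in this domain a factor \<open>T\<close> can be cancelled.\<close>

definition tangent_eval :: "(nat \<Rightarrow> 'a) \<Rightarrow> (nat \<Rightarrow> 'a) \<Rightarrow> 'a mpol \<Rightarrow> 'a poly" where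
  "tangent_eval w v = mpoly_eval (\<lambda>c. [:c:]) (\<lambda>j. [:w j, v j:])"

lemma tangent_eval_hom: "comm_ring_hom (tangent_eval w v)"
  unfolding tangent_eval_def by (rule mpoly_eval_hom.eval_comm_ring_hom[OF poly_eval_hom])

lemma tangent_eval_simps:
  "tangent_eval w v (mvar j) = [:w j, v j:]" "tangent_eval w v (mconst a) = [:a:]"
  by (simp_all add: tangent_eval_def mpoly_eval_hom.eval_mvar[OF poly_eval_hom] mpoly_eval_hom.eval_mconst[OF poly_eval_hom])

lemma tangent_eval_Ax:
  "tangent_eval w v (Ax k) = [:\<Sum>l<r. A $$ (k, l) * w l, \<Sum>l<r. A $$ (k, l) * v l:]"
proof -
  have "tangent_eval w v (Ax k) = (\<Sum>l<r. [:A $$ (k, l) * w l, A $$ (k, l) * v l:])"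
    by (simp add: tangent_eval_def mpoly_eval_hom.eval_lform[OF poly_eval_hom] mult.commute)
  also have "\<dots> = [:\<Sum>l<r. A $$ (k, l) * w l, \<Sum>l<r. A $$ (k, l) * v l:]"
    by (induction r) auto
  finally show ?thesis .
qed

lemma tangent_eval_at_0:
  assumes "p \<in> carrier (mpoly_ring r)"
  shows "poly (tangent_eval w v p) 0 = mpoly_eval (\<lambda>c. c) w p"
proof (rule mpoly_homs_eqI[OF _ _ assms, of "\<lambda>p. poly (tangent_eval w v p) 0"])
  interpret comm_ring_hom "tangent_eval w v" by (rule tangent_eval_hom)
  show "comm_ring_hom (\<lambda>p. poly (tangent_eval w v p) 0)"
    by unfold_locales (simp_all add: hom_add hom_mult)
  show "comm_ring_hom (mpoly_eval (\<lambda>c. c) w)"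
    by (rule mpoly_eval_hom.eval_comm_ring_hom[OF point_eval_hom])
qed (simp_all add: tangent_eval_simps mpoly_eval_hom.eval_mvar[OF point_eval_hom] mpoly_eval_hom.eval_mconst[OF point_eval_hom])

text \<open>The chain \<open>A v = c v + w\<close>, \<open>A w = c w\<close> makes \<open>w + T v\<close> a point of the eigenscheme with values in
  the dual numbers, lying over the eigenvector \<open>w\<close> and having the eigenvalue \<open>c + T\<close>.\<close>
lemma eigen_ideal_tangent:
  assumes w: "\<And>k. k < r \<Longrightarrow> (\<Sum>l<r. A $$ (k, l) * w l) = c * w k"
    and v: "\<And>k. k < r \<Longrightarrow> (\<Sum>l<r. A $$ (k, l) * v l) = c * v k + w k"
    and f: "f \<in> eigen_ideal r A"
  shows "[:0, 1:] * [:0, 1:] dvd tangent_eval w v f"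
proof (rule eigen_ideal_dvd_hom[OF tangent_eval_hom _ f])
  interpret comm_ring_hom "tangent_eval w v" by (rule tangent_eval_hom)
  have Ax_eval: "tangent_eval w v (Ax k) = [:c * w k, c * v k + w k:]" if "k < r" for k
    using that by (simp add: tangent_eval_Ax w v)
  fix i j assume "i < j" "j < r"
  then have "tangent_eval w v (eigen_minor r A i j) = ([:0, 1:] * [:0, 1:]) * [:w i * v j - w j * v i:]"
    by (simp add: eigen_minor_def hom_minus hom_mult Ax_eval tangent_eval_simps) (simp add: algebra_simps)
  then show "[:0, 1:] * [:0, 1:] dvd tangent_eval w v (eigen_minor r A i j)"
    by (simp only: dvd_triv_left)
qed

text \<open>The factor for \<open>b\<close> becomes
  \<open>(c - b) w_i + T ((c - b) v_i + w_i)\<close>. For \<open>b = c\<close> this is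
  \<open>w_i T\<close>, and for every other \<open>b\<close> the constant term is nonzero, so
  \<open>T\<close> divides the product exactly once.\<close>

lemma tangent_eval_product:
  assumes w: "\<And>k. k < r \<Longrightarrow> (\<Sum>l<r. A $$ (k, l) * w l) = c * w k"
    and v: "\<And>k. k < r \<Longrightarrow> (\<Sum>l<r. A $$ (k, l) * v l) = c * v k + w k"
    and i: "i < r" "w i \<noteq> 0" and S: "finite S" "c \<in> S"
  shows "\<exists>g. tangent_eval w v (\<Prod>b\<in>S. Ax i - mconst b * mvar i) = [:0, 1:] * g \<and> poly g 0 \<noteq> 0"
proof -
  interpret comm_ring_hom "tangent_eval w v" by (rule tangent_eval_hom)
  let ?h = "\<lambda>b. [:(c - b) * w i, (c - b) * v i + w i:]"
  have "tangent_eval w v (Ax i - mconst b * mvar i) = ?h b" for b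
    using i(1) by (simp add: hom_minus hom_mult tangent_eval_Ax tangent_eval_simps w v) (simp add: algebra_simps)
  then have "tangent_eval w v (\<Prod>b\<in>S. Ax i - mconst b * mvar i) = (\<Prod>b\<in>S. ?h b)"
    by (simp only: hom_prod)
  also have "\<dots> = ?h c * (\<Prod>b\<in>S - {c}. ?h b)"
    using S by (rule prod.remove)
  also have "\<dots> = [:0, 1:] * ([:w i:] * (\<Prod>b\<in>S - {c}. ?h b))"
    by simp
  finally show ?thesis
    using i(2) S(1) by (intro exI conjI) (auto simp: poly_prod)
qed

text \<open>Reducedness makes the nilpotent fraction zero at the point of \<open>w\<close>, so
  \<open>t * a\<close> lies in the ideal for some \<open>t\<close> with nonzero value at
  \<open>w\<close>. Along \<open>w + T v\<close> this product would have to be divisible by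
  \<open>T^2\<close>, but \<open>a\<close> contributes exactly one factor \<open>T\<close> and
  \<open>t\<close> none.\<close>

lemma semisimple_if_reduced:
  assumes red: "reduced_scheme (eigenscheme r A)" and cs: "char_poly A = (\<Prod>c\<leftarrow>cs. [:- c, 1:])"
  shows "semisimple_mat A"
  unfolding semisimple_mat_def
proof (intro allI ballI impI, rule ccontr)
  fix c u
  define z where "z = A *\<^sub>v u - c \<cdot>\<^sub>v u"
  assume "u \<in> carrier_vec (dim_row A)" and z: "A *\<^sub>v (A *\<^sub>v u - c \<cdot>\<^sub>v u) = c \<cdot>\<^sub>v (A *\<^sub>v u - c \<cdot>\<^sub>v u)"
    and ne: "A *\<^sub>v u \<noteq> c \<cdot>\<^sub>v u"
  then have u: "u \<in> carrier_vec r" using A by simp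
  have zc: "z \<in> carrier_vec r" using A u by (simp add: z_def)
  define v where "v k = vec_index u k" for k
  define w where "w k = vec_index z k" for k
  have w: "(\<Sum>l<r. A $$ (k, l) * w l) = c * w k" if "k < r" for k
    using arg_cong[OF z[folded z_def], of "\<lambda>x. vec_index x k"] that A zc
    by (simp add: w_def scalar_prod_def atLeast0LessThan)
  have v: "(\<Sum>l<r. A $$ (k, l) * v l) = c * v k + w k" if "k < r" for k
    using that A u by (simp add: w_def v_def z_def scalar_prod_def atLeast0LessThan)
  have "\<exists>i<r. w i \<noteq> 0"
  proof (rule ccontr)
    assume "\<not> ?thesis"
    then have z0: "vec_index z k = 0" if "k < r" for k
      using that by (auto simp: w_def)
    have "A *\<^sub>v u = c \<cdot>\<^sub>v u"
    proof (rule eq_vecI)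
      fix k assume "k < dim_vec (c \<cdot>\<^sub>v u)"
      then have k: "k < r" using u by simp
      have "vec_index z k = vec_index (A *\<^sub>v u) k - vec_index (c \<cdot>\<^sub>v u) k"
        unfolding z_def using A u k by (intro index_minus_vec(1)) simp
      then show "vec_index (A *\<^sub>v u) k = vec_index (c \<cdot>\<^sub>v u) k"
        using z0[OF k] by simp
    qed (use A u in simp)
    then show False using ne by contradiction
  qed
  \<comment> \<open>The index fixes the chart of \<open>x_i\<close>, chosen so that it contains the
    point of \<open>w\<close>.\<close>
  then obtain i where i: "i < r" "w i \<noteq> 0" by blast
  have "z \<noteq> 0\<^sub>v r" using i by (auto simp: w_def)
  then have "eigenvector A z c" using A zc z by (simp add: eigenvector_def z_def)
  then have "poly (char_poly A) c = 0"
    using eigenvalue_root_char_poly[OF A] by (auto simp: eigenvalue_def)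
  then have c: "c \<in> set cs"
    unfolding cs by (auto simp: poly_prod_list o_def prod_list_zero_iff)
  \<comment> \<open>\<open>a\<close> and \<open>x\<close> share the number of distinct eigenvalues
    as degree, so \<open>a/x\<close> has degree zero: it is the product of the
    \<open>\<Lambda> - b\<close> on the chosen chart.\<close>
  define a where "a = (\<Prod>b\<in>set cs. Ax i - mconst b * mvar i)"
  define x where "x = (mvar i :: 'a mpol) ^ card (set cs)"
  have a_gr: "a \<in> mpoly_grading r (card (set cs))"
    unfolding a_def using mpoly_grading_mult[OF mpoly_grading_mconst mpoly_grading_mvar[OF i(1)]]
    by (intro mpoly_grading_prod mpoly_grading_diff mpoly_grading_lform) simp_all
  have x_gr: "x \<in> mpoly_grading r (card (set cs))"
    unfolding x_def by (rule mpoly_grading_power[OF mpoly_grading_mvar[OF i(1)]])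
  have a: "a \<in> carrier (mpoly_ring r)" and x: "x \<in> carrier (mpoly_ring r)"
    using a_gr x_gr by (simp_all add: mpoly_grading_def)
  have sub: "eigen_ideal r A \<subseteq> quot.line_ideal w"
    using w by (rule eigen_ideal_line_subset)
  interpret line: comm_ring_hom "line_eval w" by (rule line_eval_hom)
  interpret tangent: comm_ring_hom "tangent_eval w v" by (rule tangent_eval_hom)
  have "line_eval w x \<noteq> 0"
    using i(2) by (simp add: x_def line.hom_power) (simp add: line_eval_def mpoly_eval_hom.eval_mvar[OF poly_eval_hom])
  then have "quot.cst x \<notin> quot.line_point w"
    by (simp add: quot.mem_line_point_iff[OF sub x])
  moreover have "quot.line_point w \<in> proj_points quot.Q quot.qgr"
    by (rule quot.line_point_in_proj_points[OF sub i])
  moreover have "quot.cst x \<otimes>\<^bsub>quot.Q\<^esub> quot.cst a [^]\<^bsub>quot.Q\<^esub> length cs = \<zero>\<^bsub>quot.Q\<^esub>"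
  proof -
    have "x * a ^ length cs \<in> eigen_ideal r A"
      unfolding x_def a_def using c by (intro nilpotent_fraction[OF i(1) cs]) auto
    then show ?thesis
      using a x by (simp add: quot.coset_power quot.coset_mult quot.coset_eq_0_iff mpoly_ring_closed)
  qed
  moreover have "reduced_scheme (Proj quot.Q quot.qgr)"
    using red by (simp only: eigenscheme_def closed_subscheme_def)
  ultimately have "\<exists>T\<in>(\<Union>d. quot.qgr d) - quot.line_point w. T \<otimes>\<^bsub>quot.Q\<^esub> quot.cst a = \<zero>\<^bsub>quot.Q\<^esub>"
    by (intro multiplicative_grading.reduced_Proj_fraction_eq_0[OF quot.grading_Q _ imageI[OF a_gr] imageI[OF x_gr]])
  then obtain T where T: "T \<in> (\<Union>d. quot.qgr d) - quot.line_point w" "T \<otimes>\<^bsub>quot.Q\<^esub> quot.cst a = \<zero>\<^bsub>quot.Q\<^esub>"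
    by (rule bexE)
  from T(1) obtain t d where t_gr: "t \<in> mpoly_grading r d" and T_eq: "T = quot.cst t" by blast
  then have t: "t \<in> carrier (mpoly_ring r)" by (simp add: mpoly_grading_def)
  have "line_eval w t \<noteq> 0"
    using T(1) unfolding T_eq Diff_iff quot.mem_line_point_iff[OF sub t] by (rule conjunct2)
  \<comment> \<open>Homogeneity of \<open>t\<close> enters here: being nonzero on the whole line
    amounts to being nonzero at \<open>w\<close>, and that value is the constant term of
    \<open>t\<close> along \<open>w + T v\<close>.\<close>
  moreover have "line_eval w t = Polynomial.monom (mpoly_eval (\<lambda>c. c) w t) d"
    using t_gr by (intro line_eval_homogeneous) (simp add: mpoly_grading_def)
  ultimately have t0: "poly (tangent_eval w v t) 0 \<noteq> 0"
    by (auto simp: tangent_eval_at_0[OF t])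
  have "t * a \<in> eigen_ideal r A"
    using T(2) t a unfolding T_eq by (simp add: quot.coset_mult quot.coset_eq_0_iff mpoly_ring_closed)
  then have "[:0, 1:] * [:0, 1:] dvd tangent_eval w v (t * a)"
    using w v by (intro eigen_ideal_tangent)
  moreover obtain g where g: "tangent_eval w v a = [:0, 1:] * g" "poly g 0 \<noteq> 0"
    using tangent_eval_product[OF w v i finite_set c] unfolding a_def by blast
  ultimately have "[:0, 1:] * [:0, 1:] dvd [:0, 1:] * (tangent_eval w v t * g)"
    by (simp only: tangent.hom_mult g(1) mult.left_commute)
  then have "[:0, 1:] dvd tangent_eval w v t * g"
    by (simp only: dvd_mult_cancel_left) simp
  then have "poly (tangent_eval w v t * g) 0 = 0"
    using poly_eq_0_iff_dvd[of "tangent_eval w v t * g" 0] by simp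
  then show False using t0 g(2) by simp
qed

end

theorem corollary4p9:
  fixes A :: "'a::field mat" and r :: nat
  assumes "r \<ge> 1"
    and "A \<in> carrier_mat r r"
    and "eigenvalues_in_field A"
  shows "(diagonalizable A \<longleftrightarrow> radical_ideal (mpoly_ring r) (eigen_ideal r A)) \<and>
         (radical_ideal (mpoly_ring r) (eigen_ideal r A) \<longleftrightarrow> reduced_scheme (eigenscheme r A))"
proof -
  interpret eigen_ideal_context r A by unfold_locales (rule assms(2))
  have "radical_ideal (mpoly_ring r) (eigen_ideal r A)" if "diagonalizable A"
    using radical_eigen_ideal_if_diagonalizable[OF assms(2) that] .
  moreover have "reduced_scheme (eigenscheme r A)" if "radical_ideal (mpoly_ring r) (eigen_ideal r A)"
    unfolding eigenscheme_def using that by (rule quot.reduced_closed_subscheme_if_radical)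
  moreover have "diagonalizable A" if "reduced_scheme (eigenscheme r A)"
    using char_poly_splits[OF assms(2,3)] semisimple_if_reduced[OF that]
      diagonalizable_if_semisimple[OF assms(2) _ assms(3)] by blast
  ultimately show ?thesis by blast
qed

end
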